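(* Let $S$ be a commutative monoid such that $R\neq\emptyset$. If the class $\mathfrak{R}$ of all regular $S$-acts is axiomatizable and primitive normal, then the class $\mathfrak{R}$ is antiadditive.
   Context: **$S$-acts.** $S$ is a monoid with identity $1$. A (left) $S$-act ${}_SA$ is a structure $\langle A;s\rangle_{s\in S}$ in the first-order language (with equality) $L_S=\{s\mid s\in S\}$ of unary function symbols such that $s_1(s_2a)=(s_1s_2)a$ and $1a=a$ for all $s_1,s_2\in S$, $a\in A$. ${}_SS$ is $S$ acting on itself by left multiplication. For $a\in A$, ${}_SSa$ is the subact generated by $a$. An element $a\in A$ is act-regular if there is a homomorphism of $S$-acts $\varphi:{}_SSa\to{}_SS$ with $\varphi(a)a=a$. An $S$-act is regular if all its elements are act-regular. $R$ denotes the union of all regular subacts of ${}_SS$. A class of $L_S$-structures is axiomatizable if it is the class of all models of some set of first-order sentences of $L_S$. **Primitive normality.** A primitive formula is a formula $\exists\bar x(\Phi_0\wedge\cdots\wedge\Phi_k)$ with all $\Phi_i$ atomic. Let $\mathcal{C}$ be a large, sufficiently saturated model of a complete theory $T$. For a primitive formula $\Phi(\bar x,\bar y)$ and tuples $\bar a,\bar b$ in $\mathcal{C}$ with $|\bar a|=|\bar b|=|\bar y|$, the set $\Phi(\mathcal{C},\bar a)=\{\bar c\mid\mathcal{C}\models\Phi(\bar c,\bar a)\}$ is called a primitive set, and $\Phi(\mathcal{C},\bar a)$, $\Phi(\mathcal{C},\bar b)$ are called primitive copies. $T$ is primitive normal if for any primitive copies $X,Y$ either $X=Y$ or $X\cap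 Y=\varnothing$. **Antiadditivity.** A primitive equivalence is an equivalence relation $\alpha$ on a set $X$ of $n$-tuples of elements of $\mathcal{C}$ that is defined in $\mathcal{C}$ by a primitive formula $\Phi(\bar x_1,\bar x_2)$; its domain $dom(\alpha)=X$ is defined by $\Phi(\bar x,\bar x)$, and $\bar a/\alpha$ is the $\alpha$-class of $\bar a$. A set is $\Delta$-primitive if it is the intersection of a family of primitive sets. A generalized primitive set is a set $X=X^*/\alpha=\{\bar a/\alpha\mid\bar a\in X^*\}$, where $X^*$ is $\Delta$-primitive, $\alpha$ is a primitive equivalence and $X^*\subseteq dom(\alpha)$. A primitive formula $\Phi(\bar x,\bar y,\bar z,\bar a)$ (with parameters $\bar a$ in $\mathcal{C}$) defines a binary operation $+$ on $X$ if for all $\bar b,\bar c,\bar d\in X^*$: $\bar b/\alpha+\bar c/\alpha=\bar d/\alpha$ if and only if $\mathcal{C}\models\Phi(\bar b,\bar c,\bar d,\bar a)$. $T$ is antiadditive if it is primitive normal and there is no infinite generalized primitive set that is an Abelian group under an operation defined by a primitive formula. **Classes.** An axiomatizable class of structures is primitive normal (respectively antiadditive) if the theory of the class (the set of sentences true in all its members) is. Since this theory need not be complete, this means that every completion of it is primitive normal (respectively antiadditive). *)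

theory Defs
  imports "HOL-Algebra.Group" "HOL-Library.Equipollence"
begin

section \<open>The language of acts over a monoid\<close>

text \<open>The function symbols are the elements of \<open>'s\<close>, all unary; variables are natural numbers.\<close>

datatype 's trm = Var nat | App 's "'s trm"

datatype 's fm = Eq "'s trm" "'s trm" | Neg "'s fm" | And "'s fm" "'s fm" | Ex nat "'s fm"

record ('s, 'u) struct = "'u partial_object" +
  interp :: "'s \<Rightarrow> 'u \<Rightarrow> 'u"

text \<open>As usual in first-order logic, structures are nonempty.\<close>

definition is_structure :: "('s, 'u) struct \<Rightarrow> bool" where
  "is_structure M \<longleftrightarrow> carrier M \<noteq> {} \<and> (\<forall>s. interp M s \<in> carrier M \<rightarrow> carrier M)"

primrec trm_val :: "('s, 'u) struct \<Rightarrow> (nat \<Rightarrow> 'u) \<Rightarrow> 's trm \<Rightarrow> 'u" where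
  "trm_val M e (Var i) = e i"
| "trm_val M e (App s t) = interp M s (trm_val M e t)"

primrec sat :: "('s, 'u) struct \<Rightarrow> (nat \<Rightarrow> 'u) \<Rightarrow> 's fm \<Rightarrow> bool" where
  "sat M e (Eq t u) \<longleftrightarrow> trm_val M e t = trm_val M e u"
| "sat M e (Neg \<phi>) \<longleftrightarrow> \<not> sat M e \<phi>"
| "sat M e (And \<phi> \<psi>) \<longleftrightarrow> sat M e \<phi> \<and> sat M e \<psi>"
| "sat M e (Ex i \<phi>) \<longleftrightarrow> (\<exists>a\<in>carrier M. sat M (e(i := a)) \<phi>)"

primrec trm_vars :: "'s trm \<Rightarrow> nat set" where
  "trm_vars (Var i) = {i}"
| "trm_vars (App s t) = trm_vars t"

primrec fv :: "'s fm \<Rightarrow> nat set" where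
  "fv (Eq t u) = trm_vars t \<union> trm_vars u"
| "fv (Neg \<phi>) = fv \<phi>"
| "fv (And \<phi> \<psi>) = fv \<phi> \<union> fv \<psi>"
| "fv (Ex i \<phi>) = fv \<phi> - {i}"

definition sentences :: "'s fm set" where
  "sentences = {\<sigma>. fv \<sigma> = {}}"

definition models :: "('s, 'u) struct \<Rightarrow> 's fm set \<Rightarrow> bool" where
  "models M T \<longleftrightarrow> is_structure M \<and> (\<forall>\<sigma>\<in>T. \<forall>e\<in>UNIV \<rightarrow> carrier M. sat M e \<sigma>)"

text \<open>
  A class of structures is given by its members with carrier inside a universe type \<open>'u\<close>.  Once
  \<open>'u\<close> has at least as many elements as there are formulas, the Loewenheim-Skolem theorem makes
  the theory of the class of regular acts, and the axiomatizability of this class, independent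
  of the choice of \<open>'u\<close>.
\<close>

definition axiomatizable :: "('s, 'u) struct set \<Rightarrow> bool" where
  "axiomatizable K \<longleftrightarrow> (\<exists>\<Gamma>\<subseteq>sentences. K = {M. models M \<Gamma>})"

definition theory_of :: "('s, 'u) struct set \<Rightarrow> 's fm set" where
  "theory_of K = {\<sigma> \<in> sentences. \<forall>M\<in>K. models M {\<sigma>}}"

definition complete_theory :: "'u itself \<Rightarrow> 's fm set \<Rightarrow> bool" where
  "complete_theory _ T \<longleftrightarrow> T \<subseteq> sentences \<and> (\<exists>M :: ('s, 'u) struct. models M T) \<and>
     (\<forall>\<sigma>\<in>sentences. \<sigma> \<in> T \<or> Neg \<sigma> \<in> T)"


section \<open>Saturated models\<close>

text \<open>
  Saturation in the successor cardinal of \<open>|L|\<close>, where \<open>L\<close> is the set of formulas: every 1-type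
  over at most \<open>|L|\<close> many parameters is realized.  A type is a set of formulas
  together with parameter lists; variable 0 is the variable of the type and variable \<open>i + 1\<close>
  stands for the \<open>i\<close>-th parameter.
\<close>

definition saturated :: "('s, 'u) struct \<Rightarrow> bool" where
  "saturated M \<longleftrightarrow> (\<forall>A\<subseteq>carrier M. A \<lesssim> (UNIV :: ('s + nat) set) \<longrightarrow>
     (\<forall>p. (\<forall>(\<phi>, as)\<in>p. as \<in> lists A \<and> fv \<phi> \<subseteq> {..<Suc (length as)}) \<and>
          (\<forall>q\<subseteq>p. finite q \<longrightarrow> (\<exists>c\<in>carrier M. \<forall>(\<phi>, as)\<in>q. sat M ((!) (c # as)) \<phi>))
        \<longrightarrow> (\<exists>c\<in>carrier M. \<forall>(\<phi>, as)\<in>p. sat M ((!) (c # as)) \<phi>)))"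

text \<open>
  The large saturated models in which primitive sets are considered.  The notions below do not
  depend on which such model of a complete theory is taken; one always exists in a universe with
  at least \<open>2 ^ |L|\<close> elements.
\<close>

definition monster :: "'s fm set \<Rightarrow> ('s, 'u) struct \<Rightarrow> bool" where
  "monster T C \<longleftrightarrow> models C T \<and> saturated C"


section \<open>Primitive normality\<close>

definition atomic :: "'s fm \<Rightarrow> bool" where
  "atomic \<phi> \<longleftrightarrow> (\<exists>t u. \<phi> = Eq t u)"

definition primitive :: "'s fm \<Rightarrow> bool" where
  "primitive \<phi> \<longleftrightarrow> (\<exists>xs \<phi>s \<phi>0. (\<forall>\<psi>\<in>set \<phi>s. atomic \<psi>) \<and> atomic \<phi>0 \<and>
     \<phi> = foldr Ex xs (foldr And \<phi>s \<phi>0))"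

definition tuples :: "('s, 'u) struct \<Rightarrow> nat \<Rightarrow> 'u list set" where
  "tuples C n = {cs \<in> lists (carrier C). length cs = n}"

text \<open>
  A formula \<open>\<Phi>(x, y, \<dots>)\<close> in tuples of variables \<open>x, y, \<dots>\<close> is a formula whose free variables are
  among \<open>0, 1, 2, \<dots>\<close>, where these numbers enumerate first \<open>x\<close>, then \<open>y\<close>, and so on; it
  is evaluated at the concatenation of the argument tuples.
\<close>

definition holds :: "('s, 'u) struct \<Rightarrow> 's fm \<Rightarrow> 'u list \<Rightarrow> bool" where
  "holds C \<Phi> cs \<longleftrightarrow> sat C ((!) cs) \<Phi>"

definition defset :: "('s, 'u) struct \<Rightarrow> nat \<Rightarrow> 's fm \<Rightarrow> 'u list \<Rightarrow> 'u list set" where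
  "defset C n \<Phi> as = {cs \<in> tuples C n. holds C \<Phi> (cs @ as)}"

definition primitive_set :: "('s, 'u) struct \<Rightarrow> nat \<Rightarrow> 'u list set \<Rightarrow> bool" where
  "primitive_set C n X \<longleftrightarrow> (\<exists>\<Phi> m. \<exists>as\<in>tuples C m.
     primitive \<Phi> \<and> fv \<Phi> \<subseteq> {..<n + m} \<and> X = defset C n \<Phi> as)"

definition primitive_copies ::
    "('s, 'u) struct \<Rightarrow> nat \<Rightarrow> 'u list set \<Rightarrow> 'u list set \<Rightarrow> bool" where
  "primitive_copies C n X Y \<longleftrightarrow> (\<exists>\<Phi> m. \<exists>as\<in>tuples C m. \<exists>bs\<in>tuples C m.
     primitive \<Phi> \<and> fv \<Phi> \<subseteq> {..<n + m} \<and> X = defset C n \<Phi> as \<and> Y = defset C n \<Phi> bs)"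

definition primitive_normal :: "'u itself \<Rightarrow> 's fm set \<Rightarrow> bool" where
  "primitive_normal _ T \<longleftrightarrow> (\<forall>C :: ('s, 'u) struct. monster T C \<longrightarrow>
     (\<forall>n X Y. primitive_copies C n X Y \<longrightarrow> X = Y \<or> X \<inter> Y = {}))"


section \<open>Antiadditivity\<close>

definition eq_dom :: "('u list \<times> 'u list) set \<Rightarrow> 'u list set" where
  "eq_dom \<alpha> = {b. (b, b) \<in> \<alpha>}"

definition primitive_equivalence ::
    "('s, 'u) struct \<Rightarrow> nat \<Rightarrow> ('u list \<times> 'u list) set \<Rightarrow> bool" where
  "primitive_equivalence C n \<alpha> \<longleftrightarrow>
     (\<exists>\<Phi>. primitive \<Phi> \<and> fv \<Phi> \<subseteq> {..<n + n} \<and>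
        \<alpha> = {(b, c) \<in> tuples C n \<times> tuples C n. holds C \<Phi> (b @ c)}) \<and>
     equiv (eq_dom \<alpha>) \<alpha>"

definition delta_primitive :: "('s, 'u) struct \<Rightarrow> nat \<Rightarrow> 'u list set \<Rightarrow> bool" where
  "delta_primitive C n X \<longleftrightarrow> (\<exists>F. F \<noteq> {} \<and> (\<forall>Y\<in>F. primitive_set C n Y) \<and> X = \<Inter>F)"

text \<open>The generalized primitive set presented by \<open>X\<close> and \<open>\<alpha>\<close> is the quotient \<open>X // \<alpha>\<close>.\<close>

definition gen_primitive ::
    "('s, 'u) struct \<Rightarrow> nat \<Rightarrow> 'u list set \<Rightarrow> ('u list \<times> 'u list) set \<Rightarrow> bool" where
  "gen_primitive C n X \<alpha> \<longleftrightarrow>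
     delta_primitive C n X \<and> primitive_equivalence C n \<alpha> \<and> X \<subseteq> eq_dom \<alpha>"

definition primitive_operation ::
    "('s, 'u) struct \<Rightarrow> nat \<Rightarrow> 'u list set \<Rightarrow> ('u list \<times> 'u list) set \<Rightarrow>
     ('u list set \<Rightarrow> 'u list set \<Rightarrow> 'u list set) \<Rightarrow> bool" where
  "primitive_operation C n X \<alpha> add \<longleftrightarrow>
     (\<exists>\<Phi> m. \<exists>as\<in>tuples C m. primitive \<Phi> \<and> fv \<Phi> \<subseteq> {..<n + n + n + m} \<and>
        (\<forall>b\<in>X. \<forall>c\<in>X. \<forall>d\<in>X.
           add (\<alpha> `` {b}) (\<alpha> `` {c}) = \<alpha> `` {d} \<longleftrightarrow> holds C \<Phi> (b @ c @ d @ as)))"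

definition antiadditive :: "'u itself \<Rightarrow> 's fm set \<Rightarrow> bool" where
  "antiadditive U T \<longleftrightarrow> primitive_normal U T \<and>
     (\<forall>C :: ('s, 'u) struct. monster T C \<longrightarrow>
        \<not> (\<exists>n X \<alpha> add zero. gen_primitive C n X \<alpha> \<and> infinite (X // \<alpha>) \<and>
             primitive_operation C n X \<alpha> add \<and>
             comm_group \<lparr>carrier = X // \<alpha>, mult = add, one = zero\<rparr>))"


section \<open>Classes of structures\<close>

definition completion :: "('s, 'u) struct set \<Rightarrow> 's fm set \<Rightarrow> bool" where
  "completion K T \<longleftrightarrow> theory_of K \<subseteq> T \<and> complete_theory TYPE('u) T"

definition primitive_normal_class :: "('s, 'u) struct set \<Rightarrow> bool" where
  "primitive_normal_class K \<longleftrightarrow> (\<forall>T. completion K T \<longrightarrow> primitive_normal TYPE('u) T)"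

definition antiadditive_class :: "('s, 'u) struct set \<Rightarrow> bool" where
  "antiadditive_class K \<longleftrightarrow> (\<forall>T. completion K T \<longrightarrow> antiadditive TYPE('u) T)"


section \<open>Regular acts\<close>

definition s_act :: "('s::monoid_mult, 'u) struct \<Rightarrow> bool" where
  "s_act M \<longleftrightarrow> is_structure M \<and> (\<forall>a\<in>carrier M. interp M 1 a = a \<and>
     (\<forall>s t. interp M s (interp M t a) = interp M (s * t) a))"

definition act_hom :: "('s, 'u) struct \<Rightarrow> ('s, 'v) struct \<Rightarrow> ('u \<Rightarrow> 'v) set" where
  "act_hom M N = {f \<in> carrier M \<rightarrow> carrier N.
     \<forall>s. \<forall>a\<in>carrier M. f (interp M s a) = interp N s (f a)}"

definition self_act :: "('s::monoid_mult, 's) struct" where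
  "self_act = \<lparr>carrier = UNIV, interp = (*)\<rparr>"

definition subact :: "('s, 'u) struct \<Rightarrow> 'u set \<Rightarrow> bool" where
  "subact M B \<longleftrightarrow> B \<noteq> {} \<and> B \<subseteq> carrier M \<and> (\<forall>s. \<forall>b\<in>B. interp M s b \<in> B)"

definition cyclic :: "('s, 'u) struct \<Rightarrow> 'u \<Rightarrow> ('s, 'u) struct" where
  "cyclic M a = M\<lparr>carrier := range (\<lambda>s. interp M s a)\<rparr>"

definition act_regular :: "('s::monoid_mult, 'u) struct \<Rightarrow> 'u \<Rightarrow> bool" where
  "act_regular M a \<longleftrightarrow> (\<exists>f\<in>act_hom (cyclic M a) self_act. interp M (f a) a = a)"

definition regular_act :: "('s::monoid_mult, 'u) struct \<Rightarrow> bool" where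
  "regular_act M \<longleftrightarrow> s_act M \<and> (\<forall>a\<in>carrier M. act_regular M a)"

definition regular_acts :: "('s::monoid_mult, 'u) struct set" where
  "regular_acts = {M. regular_act M}"

text \<open>The union \<open>R\<close> of all regular subacts of the monoid acting on itself.\<close>

definition regular_part :: "'s::monoid_mult set" where
  "regular_part = \<Union>{B. subact self_act B \<and> regular_act (self_act\<lparr>carrier := B\<rparr>)}"

end

theory Submission
  imports Defs
begin

text \<open>
  The theorem holds because a regular act \<open>C\<close> over \<open>S\<close> has a majority operation: a homomorphism
  \<open>m : C \<times> C \<times> C \<rightarrow> C\<close> with \<open>m x x y = m x y x = m y x x = x\<close>.  Such an operation, applied
  coordinatewise, preserves every relation defined by a primitive formula with parameters, and no
  group with more than one element has an operation so defined: from \<open>0 + 0 = 0\<close>, \<open>0 + g = g\<close> and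
  \<open>g + 0 = g\<close> the majority operation produces \<open>0 + 0 = g\<close>.

  The majority operation compares the ideals \<open>I x y = {s. s x = s y}\<close> of \<open>S\<close>, which measure how close
  two elements are; \<open>m x y z\<close> is \<open>y\<close> if \<open>I x y \<subset> I y z\<close>, and \<open>x\<close> otherwise.  It is a homomorphism as
  soon as for all \<open>p\<close> and \<open>q\<close> in \<open>S\<close> one of them acts on \<open>x\<close>, \<open>y\<close>, \<open>z\<close> as a multiple of the other
  (\<open>majority_interp\<close>).

  This comparability follows from primitive normality (\<open>comparable_on_triples\<close>).  Each element \<open>a\<close> of
  a regular act generates a copy of \<open>S e\<close> for an idempotent \<open>e\<close>.  If two such idempotents, or two
  multiples \<open>s e\<close> and \<open>t e\<close>, were incomparable for divisibility, then three cyclic acts could be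
  glued to a regular act in which the formula \<open>\<exists>w. s w = x \<and> t w = y\<close> violates primitive
  normality (\<open>amalgam_dichotomy\<close>).

  Primitive normality speaks about saturated models only, so the glued act has to be embedded
  elementarily into a saturated structure in the given universe.  Such an extension is
  built from ultrapowers and Zorn's lemma (\<open>saturated_elementary_extension_exists\<close>).
\<close>

section \<open>Elementary embeddings\<close>

lemma trm_val_cong:
  "(\<And>i. i \<in> trm_vars t \<Longrightarrow> e i = e' i) \<Longrightarrow> trm_val M e t = trm_val M e' t"
  by (induction t) auto

lemma sat_cong:
  "(\<And>i. i \<in> fv \<phi> \<Longrightarrow> e i = e' i) \<Longrightarrow> sat M e \<phi> \<longleftrightarrow> sat M e' \<phi>"
proof (induction \<phi> arbitrary: e e')
  case (Eq t u)
  then show ?case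
    using trm_val_cong[of t e e' M] trm_val_cong[of u e e' M] by simp
next
  case (Neg \<phi>)
  then show ?case
    by (metis fv.simps(2) sat.simps(2))
next
  case (And \<phi> \<psi>)
  have "sat M e \<phi> \<longleftrightarrow> sat M e' \<phi>" "sat M e \<psi> \<longleftrightarrow> sat M e' \<psi>"
    using And.IH[of e e'] And.prems by auto
  then show ?case
    by simp
next
  case (Ex i \<phi>)
  have "sat M (e(i := a)) \<phi> \<longleftrightarrow> sat M (e'(i := a)) \<phi>" for a
    by (rule Ex.IH) (use Ex.prems in auto)
  then show ?case
    by simp
qed

lemma env_upd: "e \<in> UNIV \<rightarrow> A \<Longrightarrow> a \<in> A \<Longrightarrow> e(i := a) \<in> UNIV \<rightarrow> A"
  by (simp add: Pi_iff)

lemma trm_val_in_carrier: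
  assumes "is_structure M" "e \<in> UNIV \<rightarrow> carrier M"
  shows "trm_val M e t \<in> carrier M"
  using assms by (induction t) (auto simp: is_structure_def Pi_iff)

definition elementary :: "('u \<Rightarrow> 'v) \<Rightarrow> ('s, 'u) struct \<Rightarrow> ('s, 'v) struct \<Rightarrow> bool" where
  "elementary h M N \<longleftrightarrow> is_structure M \<and> is_structure N \<and> h \<in> carrier M \<rightarrow> carrier N \<and>
     (\<forall>\<phi>. \<forall>e\<in>UNIV \<rightarrow> carrier M. sat N (h \<circ> e) \<phi> \<longleftrightarrow> sat M e \<phi>)"

lemma elementaryD:
  assumes "elementary h M N"
  shows "is_structure M" "is_structure N" "\<And>a. a \<in> carrier M \<Longrightarrow> h a \<in> carrier N"
    "\<And>\<phi> e. e \<in> UNIV \<rightarrow> carrier M \<Longrightarrow> sat N (h \<circ> e) \<phi> \<longleftrightarrow> sat M e \<phi>"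
  using assms unfolding elementary_def by auto

lemma elementary_id_sat:
  assumes "elementary id M N" "e \<in> UNIV \<rightarrow> carrier M"
  shows "sat N e \<phi> \<longleftrightarrow> sat M e \<phi>"
  using elementaryD(4)[OF assms] by simp

lemma elementary_refl: "is_structure M \<Longrightarrow> elementary id M M"
  by (simp add: elementary_def)

lemma elementary_comp:
  assumes "elementary f L M" "elementary g M N"
  shows "elementary (g \<circ> f) L N"
proof -
  have "sat N (g \<circ> f \<circ> e) \<phi> \<longleftrightarrow> sat L e \<phi>" if "e \<in> UNIV \<rightarrow> carrier L" for e \<phi>
    using that elementaryD(4)[OF assms(1), of e \<phi>] elementaryD(4)[OF assms(2), of "f \<circ> e" \<phi>]
      elementaryD(3)[OF assms(1)]
    by (auto simp: comp_assoc Pi_iff)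
  then show ?thesis
    using assms by (auto simp: elementary_def)
qed

lemma elementary_id_trans:
  "elementary id L M \<Longrightarrow> elementary id M N \<Longrightarrow> elementary id L N"
  using elementary_comp[of id L M id N] by simp

lemma elementary_interp:
  assumes "elementary h M N" "a \<in> carrier M"
  shows "interp N s (h a) = h (interp M s a)"
proof -
  let ?e = "(\<lambda>_. a)(0 := interp M s a)"
  have e: "?e \<in> UNIV \<rightarrow> carrier M"
    using assms elementaryD(1)[OF assms(1)] by (simp add: is_structure_def Pi_iff)
  show ?thesis
    using elementaryD(4)[OF assms(1) e, of "Eq (Var 0) (App s (Var 1))"] by simp
qed

lemma elementary_inj_on:
  assumes "elementary h M N"
  shows "inj_on h (carrier M)"
proof (rule inj_onI)
  fix a b assume "a \<in> carrier M" "b \<in> carrier M" "h a = h b"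
  moreover from this have "(\<lambda>_. a)(0 := b) \<in> UNIV \<rightarrow> carrier M"
    by auto
  ultimately show "a = b"
    using elementaryD(4)[OF assms, of "(\<lambda>_. a)(0 := b)" "Eq (Var 0) (Var 1)"] by simp
qed

text \<open>
  An environment given by a list is arbitrary beyond the length of the list; only the values at the
  free variables matter, and these lie in the carrier.
\<close>

lemma elementary_sat_list:
  assumes h: "elementary h M N" and cs: "set cs \<subseteq> carrier M" and fv: "fv \<phi> \<subseteq> {..<length cs}"
  shows "sat N ((!) (map h cs)) \<phi> \<longleftrightarrow> sat M ((!) cs) \<phi>"
proof -
  obtain a where a: "a \<in> carrier M"
    using elementaryD(1)[OF h] by (auto simp: is_structure_def)
  define e where "e = (\<lambda>i. if i < length cs then cs ! i else a)"
  have e: "e \<in> UNIV \<rightarrow> carrier M"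
    using cs a by (auto simp: e_def subset_iff)
  have "sat N ((!) (map h cs)) \<phi> \<longleftrightarrow> sat N (h \<circ> e) \<phi>"
    by (rule sat_cong) (use fv in \<open>auto simp: e_def\<close>)
  also have "\<dots> \<longleftrightarrow> sat M e \<phi>"
    using elementaryD(4)[OF h e] .
  also have "\<dots> \<longleftrightarrow> sat M ((!) cs) \<phi>"
    by (rule sat_cong) (use fv in \<open>auto simp: e_def\<close>)
  finally show ?thesis .
qed

lemma isomorphism_is_structure:
  assumes M: "is_structure M" and N: "carrier N = h ` carrier M"
    and hom: "\<And>s a. a \<in> carrier M \<Longrightarrow> interp N s (h a) = h (interp M s a)"
  shows "is_structure N"
  using assms by (auto simp: is_structure_def Pi_iff)

lemma isomorphism_elementary:
  assumes M: "is_structure M" and inj: "inj_on h (carrier M)" and N: "carrier N = h ` carrier M"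
    and hom: "\<And>s a. a \<in> carrier M \<Longrightarrow> interp N s (h a) = h (interp M s a)"
  shows "elementary h M N"
proof -
  have trm: "trm_val N (h \<circ> e) t = h (trm_val M e t)" if "e \<in> UNIV \<rightarrow> carrier M" for e t
    using that trm_val_in_carrier[OF M that] by (induction t) (auto simp: hom)
  have "sat N (h \<circ> e) \<phi> \<longleftrightarrow> sat M e \<phi>" if "e \<in> UNIV \<rightarrow> carrier M" for e \<phi>
    using that
  proof (induction \<phi> arbitrary: e)
    case (Eq t u)
    show ?case
      unfolding sat.simps trm[OF Eq] by (rule inj_on_eq_iff[OF inj]) (rule trm_val_in_carrier[OF M Eq])+
  next
    case (Ex i \<phi>)
    have "sat N ((h \<circ> e)(i := h a)) \<phi> \<longleftrightarrow> sat M (e(i := a)) \<phi>" if "a \<in> carrier M" for a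
    proof -
      have "e(i := a) \<in> UNIV \<rightarrow> carrier M"
        by (rule env_upd[OF Ex.prems that])
      moreover have "(h \<circ> e)(i := h a) = h \<circ> e(i := a)"
        by auto
      ultimately show ?thesis
        using Ex.IH by metis
    qed
    then show ?case
      by (auto simp: N simp del: comp_apply)
  qed auto
  then show ?thesis
    using isomorphism_is_structure[OF M N hom] M N by (auto simp: elementary_def)
qed

definition iso_image :: "('u \<Rightarrow> 'v) \<Rightarrow> ('s, 'u) struct \<Rightarrow> ('s, 'v) struct" where
  "iso_image h M = \<lparr>carrier = h ` carrier M,
     interp = (\<lambda>s b. h (interp M s (inv_into (carrier M) h b)))\<rparr>"

lemma elementary_iso_image:
  assumes "is_structure M" "inj_on h (carrier M)"
  shows "elementary h M (iso_image h M)"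
  by (rule isomorphism_elementary) (use assms in \<open>auto simp: iso_image_def\<close>)

lemma saturated_isomorphic:
  fixes M :: "('s, 'u) struct" and N :: "('s, 'v) struct"
  assumes h: "elementary h M N" and surj: "carrier N = h ` carrier M" and M: "saturated M"
  shows "saturated N"
  unfolding saturated_def
proof (intro allI impI)
  fix A and p :: "('s fm \<times> 'v list) set"
  assume A: "A \<subseteq> carrier N" "A \<lesssim> (UNIV :: ('s + nat) set)"
    and p: "(\<forall>(\<phi>, as)\<in>p. as \<in> lists A \<and> fv \<phi> \<subseteq> {..<Suc (length as)}) \<and>
      (\<forall>q\<subseteq>p. finite q \<longrightarrow> (\<exists>c\<in>carrier N. \<forall>(\<phi>, as)\<in>q. sat N ((!) (c # as)) \<phi>))"
  define B where "B = {b \<in> carrier M. h b \<in> A}"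
  define p' where "p' = {(\<phi>, bs). bs \<in> lists B \<and> (\<phi>, map h bs) \<in> p}"
  have sat: "sat N ((!) (h c # map h bs)) \<phi> \<longleftrightarrow> sat M ((!) (c # bs)) \<phi>"
    if "c \<in> carrier M" "(\<phi>, bs) \<in> p'" for c \<phi> bs
    using elementary_sat_list[OF h, of "c # bs" \<phi>] that p by (fastforce simp: p'_def B_def)
  have "h ` B = A"
    using A surj by (auto simp: B_def)
  moreover have "inj_on h B"
    by (rule inj_on_subset[OF elementary_inj_on[OF h]]) (auto simp: B_def)
  ultimately have "B \<lesssim> A"
    unfolding lepoll_def by auto
  then have B: "B \<subseteq> carrier M" "B \<lesssim> (UNIV :: ('s + nat) set)"
    using A lepoll_trans by (auto simp: B_def)
  have p'1: "\<forall>(\<phi>, as)\<in>p'. as \<in> lists B \<and> fv \<phi> \<subseteq> {..<Suc (length as)}"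
    using p by (fastforce simp: p'_def)
  have p'2: "\<exists>c\<in>carrier M. \<forall>(\<phi>, as)\<in>q. sat M ((!) (c # as)) \<phi>" if q: "q \<subseteq> p'" "finite q" for q
  proof -
    have "(\<lambda>(\<phi>, bs). (\<phi>, map h bs)) ` q \<subseteq> p"
      using q by (auto simp: p'_def)
    then obtain c where c: "c \<in> carrier N"
        "\<forall>(\<phi>, as)\<in>(\<lambda>(\<phi>, bs). (\<phi>, map h bs)) ` q. sat N ((!) (c # as)) \<phi>"
      using p q(2) by (meson finite_imageI)
    then obtain c' where c': "c' \<in> carrier M" "c = h c'"
      using surj by auto
    have "sat M ((!) (c' # bs)) \<phi>" if "(\<phi>, bs) \<in> q" for \<phi> bs
      using c(2) sat[OF c'(1)] that q(1) c'(2) by fastforce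
    then show ?thesis
      using c'(1) by blast
  qed
  obtain c where c: "c \<in> carrier M" "\<forall>(\<phi>, as)\<in>p'. sat M ((!) (c # as)) \<phi>"
    using M[unfolded saturated_def, rule_format, OF B, of p'] p'1 p'2 by blast
  have "sat N ((!) (h c # as)) \<phi>" if "(\<phi>, as) \<in> p" for \<phi> as
  proof -
    have "as \<in> lists (h ` B)"
      using p that \<open>h ` B = A\<close> by auto
    then obtain bs where bs: "as = map h bs" "bs \<in> lists B"
      unfolding lists_image by auto
    then show ?thesis
      using c sat[OF c(1), of \<phi> bs] that by (auto simp: p'_def)
  qed
  then show "\<exists>c\<in>carrier N. \<forall>(\<phi>, as)\<in>p. sat N ((!) (c # as)) \<phi>"
    using elementaryD(3)[OF h c(1)] by blast
qed

section \<open>Cardinalities\<close>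

lemma infinite_inj_pair:
  assumes "infinite (UNIV :: 'a set)"
  obtains p :: "'a \<times> 'a \<Rightarrow> 'a" where "inj p"
  using card_of_Times_same_infinite[OF assms, folded card_of_ordIso] that
  by (auto simp: bij_betw_def)

primrec trm_code :: "(('s + nat) \<times> ('s + nat) \<Rightarrow> 's + nat) \<Rightarrow> 's trm \<Rightarrow> 's + nat" where
  "trm_code p (Var i) = p (Inr 0, Inr i)"
| "trm_code p (App s t) = p (Inl s, trm_code p t)"

primrec fm_code :: "(('s + nat) \<times> ('s + nat) \<Rightarrow> 's + nat) \<Rightarrow> 's fm \<Rightarrow> 's + nat" where
  "fm_code p (Eq t u) = p (Inr 0, p (trm_code p t, trm_code p u))"
| "fm_code p (Neg \<phi>) = p (Inr 1, fm_code p \<phi>)"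
| "fm_code p (And \<phi> \<psi>) = p (Inr 2, p (fm_code p \<phi>, fm_code p \<psi>))"
| "fm_code p (Ex i \<phi>) = p (Inr 3, p (Inr i, fm_code p \<phi>))"

lemma infinite_sum_nat: "infinite (UNIV :: ('s + nat) set)"
  by (simp add: finite_Plus_UNIV_iff)

lemma inj_fm:
  obtains f :: "'s fm \<Rightarrow> 's + nat" where "inj f"
proof -
  obtain p :: "('s + nat) \<times> ('s + nat) \<Rightarrow> 's + nat" where p: "inj p"
    using infinite_inj_pair[OF infinite_sum_nat] .
  have trm: "trm_code p t = trm_code p u \<Longrightarrow> t = u" for t u
  proof (induction t arbitrary: u)
    case (Var i)
    then show ?case
      by (cases u) (auto simp: inj_eq[OF p])
  next
    case (App s t)
    then show ?case
      by (cases u) (auto simp: inj_eq[OF p])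
  qed
  have "fm_code p \<phi> = fm_code p \<psi> \<Longrightarrow> \<phi> = \<psi>" for \<phi> \<psi>
  proof (induction \<phi> arbitrary: \<psi>)
    case (Eq t u)
    then show ?case
      by (cases \<psi>) (auto simp: inj_eq[OF p] dest: trm)
  next
    case (Neg \<phi>)
    then show ?case
      by (cases \<psi>) (auto simp: inj_eq[OF p])
  next
    case (And \<phi> \<phi>')
    then show ?case
      by (cases \<psi>) (auto simp: inj_eq[OF p])
  next
    case (Ex i \<phi>)
    then show ?case
      by (cases \<psi>) (auto simp: inj_eq[OF p])
  qed
  then have "inj (fm_code p)"
    by (rule injI)
  then show ?thesis
    by (rule that)
qed

lemma infinite_inj_list:
  assumes inf: "infinite (UNIV :: 'a set)"
  obtains f :: "'a list \<Rightarrow> 'a" where "inj f"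
proof -
  obtain p :: "'a \<times> 'a \<Rightarrow> 'a" where p: "inj p"
    using infinite_inj_pair[OF inf] .
  obtain a b :: 'a where ab: "a \<noteq> b"
    using inf by (metis UNIV_eq_I finite.emptyI finite_insert singletonI)
  define f where "f xs = foldr (\<lambda>x r. p (a, p (x, r))) xs (p (b, b))" for xs
  have "f xs = f ys \<Longrightarrow> xs = ys" for xs ys
  proof (induction xs arbitrary: ys)
    case Nil
    then show ?case
      using ab by (cases ys) (auto simp: f_def inj_eq[OF p])
  next
    case (Cons x xs)
    then show ?case
      using ab by (cases ys) (auto simp: f_def inj_eq[OF p])
  qed
  then have "inj f"
    by (rule injI)
  then show ?thesis
    by (rule that)
qed

text \<open>The inequality \<open>(2 ^ k) ^ k \<le> 2 ^ k\<close>: a function is coded by its graph.\<close>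

lemma infinite_inj_fun:
  assumes inf: "infinite (UNIV :: 'k set)" and a: "inj (a :: 'i \<Rightarrow> 'k)"
    and b: "inj (b :: 'x \<Rightarrow> 'k set)"
  obtains f :: "('i \<Rightarrow> 'x) \<Rightarrow> 'k set" where "inj f"
proof -
  obtain p :: "'k \<times> 'k \<Rightarrow> 'k" where p: "inj p"
    using infinite_inj_pair[OF inf] .
  define f where "f g = {p (a i, y) | i y. y \<in> b (g i)}" for g
  have fiber: "b (g i) = {y. p (a i, y) \<in> f g}" for g i
    by (auto simp: f_def inj_eq[OF p] inj_eq[OF a])
  have "inj f"
  proof (rule injI)
    fix g g' assume "f g = f g'"
    then have "b (g i) = b (g' i)" for i
      by (simp add: fiber)
    then show "g = g'"
      by (auto simp: inj_eq[OF b])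
  qed
  then show ?thesis
    by (rule that)
qed

section \<open>Regular ultrafilters and ultrapowers\<close>

definition ultrafilter :: "'i filter \<Rightarrow> bool" where
  "ultrafilter U \<longleftrightarrow> U \<noteq> bot \<and> (\<forall>P. eventually P U \<or> eventually (\<lambda>i. \<not> P i) U)"

lemma ultrafilter_not_iff:
  assumes "ultrafilter U"
  shows "eventually (\<lambda>i. \<not> P i) U \<longleftrightarrow> \<not> eventually P U"
proof
  assume "eventually (\<lambda>i. \<not> P i) U"
  then show "\<not> eventually P U"
    using assms eventually_conj[of P U "\<lambda>i. \<not> P i"]
    by (auto simp: ultrafilter_def trivial_limit_def)
qed (use assms in \<open>auto simp: ultrafilter_def\<close>)

lemma ultrafilter_exists:
  assumes F: "F \<noteq> bot"
  obtains U where "ultrafilter U" "U \<le> F"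
proof -
  let ?A = "{G. G \<noteq> bot \<and> G \<le> F}" and ?P = "\<lambda>G H :: 'a filter. H \<le> G"
  have "\<exists>U\<in>?A. \<forall>G\<in>?A. ?P U G \<longrightarrow> G = U"
  proof (rule predicate_Zorn)
    show "partial_order_on ?A (relation_of ?P ?A)"
      by (rule partial_order_on_relation_ofI) auto
  next
    fix C assume C: "C \<in> Chains (relation_of ?P ?A)"
    show "\<exists>u\<in>?A. \<forall>a\<in>C. ?P a u"
    proof (cases "C = {}")
      case True
      then show ?thesis
        using F by auto
    next
      case False
      have CA: "C \<subseteq> ?A" and comparable: "\<And>G H. G \<in> C \<Longrightarrow> H \<in> C \<Longrightarrow> G \<le> H \<or> H \<le> G"
        using C by (auto simp: Chains_def relation_of_def)
      have "\<exists>x\<in>C. x \<le> inf G H" if "G \<in> C" "H \<in> C" for G H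
        using comparable[OF that] that by (metis inf.absorb1 inf.absorb2 order_refl)
      then have "Inf C \<noteq> bot"
        using eventually_Inf_base[OF False, of "\<lambda>_. False"] CA by (auto simp: trivial_limit_def)
      moreover have "Inf C \<le> F"
        using False CA by (metis (no_types, lifting) Inf_lower2 ex_in_conv mem_Collect_eq subset_iff)
      ultimately show ?thesis
        by (auto intro: Inf_lower)
    qed
  qed
  then obtain U where U: "U \<noteq> bot" "U \<le> F"
    and max: "\<And>G. G \<noteq> bot \<Longrightarrow> G \<le> U \<Longrightarrow> G = U"
    by (auto dest: order_trans)
  have "eventually P U" if "\<not> eventually (\<lambda>i. \<not> P i) U" for P
  proof -
    have "inf U (principal {i. P i}) \<noteq> bot"
      using that by (simp add: trivial_limit_def eventually_inf_principal)
    then have "inf U (principal {i. P i}) = U"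
      by (rule max) simp
    moreover have "eventually P (inf U (principal {i. P i}))"
      by (simp add: eventually_inf_principal)
    ultimately show ?thesis
      by simp
  qed
  then have "ultrafilter U"
    using U(1) by (auto simp: ultrafilter_def)
  then show ?thesis
    using U(2) that by blast
qed

text \<open>
  In an ultrapower modulo this ultrafilter, a sequence whose \<open>l\<close>-th term satisfies the finitely many
  conditions with indices in \<open>l\<close> satisfies all conditions.
\<close>

lemma regular_ultrafilter_exists:
  obtains U :: "'k list filter" where "ultrafilter U" "\<And>k. eventually (\<lambda>l. k \<in> set l) U"
proof -
  define F :: "'k list filter" where "F = (INF k. principal {l. k \<in> set l})"
  have "F \<noteq> bot"
    unfolding F_def
  proof (rule INF_filter_not_bot)
    fix X :: "'k set" assume "finite X"
    then obtain l where l: "set l = X"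
      using finite_list by blast
    then have "principal {l} \<le> (INF k\<in>X. principal {l. k \<in> set l})"
      by (intro INF_greatest) auto
    then show "(INF k\<in>X. principal {l. k \<in> set l}) \<noteq> bot"
      by (metis bot_unique insert_not_empty principal_eq_bot_iff)
  qed
  then obtain U where U: "ultrafilter U" "U \<le> F"
    using ultrafilter_exists by blast
  have "eventually (\<lambda>l. k \<in> set l) F" for k
    unfolding F_def by (rule eventually_INF1[of k]) (auto simp: eventually_principal)
  then show ?thesis
    using that U filter_leD by blast
qed

text \<open>
  The ultrapower, with the class of a function \<open>f\<close> named \<open>nm f\<close>: the names are at our disposal, so
  that the ultrapower can be made an extension of the given structure, and can be placed inside a
  prescribed set.
\<close>

definition ultrapower :: "(('i \<Rightarrow> 'u) \<Rightarrow> 'v) \<Rightarrow> ('s, 'u) struct \<Rightarrow> ('s, 'v) struct" where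
  "ultrapower nm M = \<lparr>carrier = nm ` (UNIV \<rightarrow> carrier M),
     interp = (\<lambda>s v. nm (\<lambda>i. interp M s (inv_into (UNIV \<rightarrow> carrier M) nm v i)))\<rparr>"

lemma
  assumes M: "is_structure M" and U: "ultrafilter U"
    and nm: "\<And>f g. f \<in> UNIV \<rightarrow> carrier M \<Longrightarrow> g \<in> UNIV \<rightarrow> carrier M \<Longrightarrow>
      nm f = nm g \<longleftrightarrow> eventually (\<lambda>i. f i = g i) U"
  shows is_structure_ultrapower: "is_structure (ultrapower nm M)"
    and los: "(\<And>j. e j \<in> UNIV \<rightarrow> carrier M) \<Longrightarrow>
      sat (ultrapower nm M) (\<lambda>j. nm (e j)) \<phi> \<longleftrightarrow> eventually (\<lambda>i. sat M (\<lambda>j. e j i) \<phi>) U"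
proof -
  have interp_in: "(\<lambda>i. interp M s (f i)) \<in> UNIV \<rightarrow> carrier M" if "f \<in> UNIV \<rightarrow> carrier M" for s f
    using that M by (auto simp: is_structure_def)
  have interp: "interp (ultrapower nm M) s (nm f) = nm (\<lambda>i. interp M s (f i))"
    if f: "f \<in> UNIV \<rightarrow> carrier M" for s f
  proof -
    let ?g = "inv_into (UNIV \<rightarrow> carrier M) nm (nm f)"
    have g: "?g \<in> UNIV \<rightarrow> carrier M"
      by (rule inv_into_into[OF imageI[OF f]])
    have "nm ?g = nm f"
      by (rule f_inv_into_f[OF imageI[OF f]])
    then have "eventually (\<lambda>i. ?g i = f i) U"
      using nm[OF g f] by simp
    then have "eventually (\<lambda>i. interp M s (?g i) = interp M s (f i)) U"
      by (rule eventually_mono) simp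
    then show ?thesis
      using nm[OF interp_in[OF g] interp_in[OF f]] by (simp add: ultrapower_def)
  qed
  show "is_structure (ultrapower nm M)"
    using M interp interp_in by (force simp: is_structure_def ultrapower_def)
  have trm: "trm_val (ultrapower nm M) (\<lambda>j. nm (e j)) t = nm (\<lambda>i. trm_val M (\<lambda>j. e j i) t)"
    and trm_in: "(\<lambda>i. trm_val M (\<lambda>j. e j i) t) \<in> UNIV \<rightarrow> carrier M"
    if "\<And>j. e j \<in> UNIV \<rightarrow> carrier M" for e t
  proof -
    show trm_in: "(\<lambda>i. trm_val M (\<lambda>j. e j i) t) \<in> UNIV \<rightarrow> carrier M" for t
      using that by (auto intro!: trm_val_in_carrier[OF M])
    show "trm_val (ultrapower nm M) (\<lambda>j. nm (e j)) t = nm (\<lambda>i. trm_val M (\<lambda>j. e j i) t)"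
      by (induction t) (auto simp: interp trm_in)
  qed
  show "sat (ultrapower nm M) (\<lambda>j. nm (e j)) \<phi> \<longleftrightarrow> eventually (\<lambda>i. sat M (\<lambda>j. e j i) \<phi>) U"
    if "\<And>j. e j \<in> UNIV \<rightarrow> carrier M"
    using that
  proof (induction \<phi> arbitrary: e)
    case (Eq t u)
    then show ?case
      by (simp add: trm trm_in nm)
  next
    case (Neg \<phi>)
    then show ?case
      by (simp add: ultrafilter_not_iff[OF U])
  next
    case (And \<phi> \<psi>)
    then show ?case
      by (simp add: eventually_conj_iff)
  next
    case (Ex k \<phi>)
    have inst: "sat (ultrapower nm M) ((\<lambda>j. nm (e j))(k := nm f)) \<phi> \<longleftrightarrow>
        eventually (\<lambda>i. sat M ((\<lambda>j. e j i)(k := f i)) \<phi>) U"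
      if "f \<in> UNIV \<rightarrow> carrier M" for f
    proof -
      have "(\<lambda>j. nm (e j))(k := nm f) = (\<lambda>j. nm ((e(k := f)) j))"
        "\<And>i. (\<lambda>j. e j i)(k := f i) = (\<lambda>j. (e(k := f)) j i)"
        by auto
      then show ?thesis
        using Ex.IH[of "e(k := f)"] Ex.prems that by simp
    qed
    show ?case
    proof
      assume "sat (ultrapower nm M) (\<lambda>j. nm (e j)) (Ex k \<phi>)"
      then obtain f where f: "f \<in> UNIV \<rightarrow> carrier M"
          "sat (ultrapower nm M) ((\<lambda>j. nm (e j))(k := nm f)) \<phi>"
        by (auto simp: ultrapower_def)
      then have "eventually (\<lambda>i. sat M ((\<lambda>j. e j i)(k := f i)) \<phi>) U"
        using inst by blast
      then show "eventually (\<lambda>i. sat M (\<lambda>j. e j i) (Ex k \<phi>)) U"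
        by (rule eventually_mono) (use f(1) in auto)
    next
      assume ev: "eventually (\<lambda>i. sat M (\<lambda>j. e j i) (Ex k \<phi>)) U"
      obtain m where m: "m \<in> carrier M"
        using M by (auto simp: is_structure_def)
      have "\<exists>a\<in>carrier M. sat M (\<lambda>j. e j i) (Ex k \<phi>) \<longrightarrow> sat M ((\<lambda>j. e j i)(k := a)) \<phi>" for i
        using m by auto
      then obtain f where f: "\<And>i. f i \<in> carrier M"
          "\<And>i. sat M (\<lambda>j. e j i) (Ex k \<phi>) \<Longrightarrow> sat M ((\<lambda>j. e j i)(k := f i)) \<phi>"
        by metis
      then have "eventually (\<lambda>i. sat M ((\<lambda>j. e j i)(k := f i)) \<phi>) U"
        by (intro eventually_mono[OF ev] f(2))
      then have "sat (ultrapower nm M) ((\<lambda>j. nm (e j))(k := nm f)) \<phi>"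
        using inst f(1) by blast
      then show "sat (ultrapower nm M) (\<lambda>j. nm (e j)) (Ex k \<phi>)"
        using f(1) by (auto simp: ultrapower_def)
    qed
  qed
qed

section \<open>Saturated elementary extensions\<close>

text \<open>
  A type with at most \<open>|K|\<close> formulas is enumerated by a function \<open>\<tau>\<close> on \<open>K\<close>, a formula being given
  together with its parameters.
\<close>

definition type_over :: "('s, 'u) struct \<Rightarrow> ('k \<Rightarrow> 's fm \<times> 'u list) \<Rightarrow> bool" where
  "type_over M \<tau> \<longleftrightarrow>
     (\<forall>k. set (snd (\<tau> k)) \<subseteq> carrier M \<and> fv (fst (\<tau> k)) \<subseteq> {..<Suc (length (snd (\<tau> k)))})"

definition realizes :: "('s, 'u) struct \<Rightarrow> ('k \<Rightarrow> 's fm \<times> 'u list) \<Rightarrow> 'k set \<Rightarrow> bool" where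
  "realizes M \<tau> Q \<longleftrightarrow> (\<exists>c\<in>carrier M. \<forall>k\<in>Q. sat M ((!) (c # snd (\<tau> k))) (fst (\<tau> k)))"

lemma realizes_elementary:
  assumes h: "elementary id M N" and over: "type_over M \<tau>" and "realizes M \<tau> Q"
  shows "realizes N \<tau> Q"
proof -
  obtain c where c: "c \<in> carrier M" "\<And>k. k \<in> Q \<Longrightarrow> sat M ((!) (c # snd (\<tau> k))) (fst (\<tau> k))"
    using assms by (auto simp: realizes_def)
  have "sat N ((!) (c # snd (\<tau> k))) (fst (\<tau> k))" if "k \<in> Q" for k
    using elementary_sat_list[OF h, of "c # snd (\<tau> k)" "fst (\<tau> k)"] c(1) c(2)[OF that] over
    by (simp add: type_over_def)
  then show ?thesis
    using elementaryD(3)[OF h c(1)] by (auto simp: realizes_def)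
qed

text \<open>
  The coordinates of the ultrapower are finite lists of elements of \<open>K\<close>, and the \<open>l\<close>-th coordinate
  of the realization realizes the finitely many formulas listed in \<open>l\<close>.  The constant functions
  keep their values as names, which makes the ultrapower an extension of \<open>M\<close>.
\<close>

lemma extension_realizing_type:
  fixes M :: "('s, 'p) struct" and \<tau> :: "'k \<Rightarrow> 's fm \<times> 'p list"
    and code :: "('k list \<Rightarrow> 'p) \<Rightarrow> 'p" and room :: "'p \<Rightarrow> 'p"
  assumes M: "is_structure M" and code: "inj code"
    and room: "inj room" "range room \<inter> carrier M = {}"
    and over: "type_over M \<tau>" and fin: "\<And>Q. finite Q \<Longrightarrow> realizes M \<tau> Q"
  obtains N where "elementary id M N" "carrier N \<subseteq> carrier M \<union> range room" "realizes N \<tau> UNIV"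
proof -
  obtain U :: "'k list filter"
    where U: "ultrafilter U" and reg: "\<And>k. eventually (\<lambda>l. k \<in> set l) U"
    using regular_ultrafilter_exists by blast
  define E where "E f g \<longleftrightarrow> eventually (\<lambda>l. f l = g l) U" for f g :: "'k list \<Rightarrow> 'p"
  have E_refl: "E f f" for f
    by (simp add: E_def)
  have E_sym: "E f g \<Longrightarrow> E g f" for f g
    unfolding E_def by (erule eventually_mono) simp
  have E_trans: "E f h" if "E f g" "E g h" for f g h
    using that unfolding E_def by (rule eventually_elim2) simp
  have E_const: "m = m'" if "E (\<lambda>_. m) (\<lambda>_. m')" for m m'
    using that U by (simp add: E_def ultrafilter_def eventually_const_iff split: if_splits)
  define isconst where "isconst f m \<longleftrightarrow> m \<in> carrier M \<and> E f (\<lambda>_. m)" for f m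
  define nm where "nm f = (if \<exists>m. isconst f m then SOME m. isconst f m
    else room (code (SOME g. E f g)))" for f
  have nm_const: "nm f = m" if "isconst f m" for f m
  proof -
    have "isconst f (SOME m. isconst f m)"
      using that by (rule someI)
    then have "(SOME m. isconst f m) = m"
      using that E_const E_trans E_sym unfolding isconst_def by blast
    then show ?thesis
      using that by (auto simp: nm_def)
  qed
  have nm_other: "nm f \<in> range room" if "\<not> (\<exists>m. isconst f m)" for f
    using that by (simp add: nm_def)
  have nm: "nm f = nm g \<longleftrightarrow> E f g" for f g
  proof
    assume "E f g"
    then have "E f h \<longleftrightarrow> E g h" for h
      using E_trans E_sym by blast
    then have "isconst f = isconst g" "E f = E g"
      by (auto simp: isconst_def fun_eq_iff)
    then show "nm f = nm g"
      by (simp add: nm_def)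
  next
    assume eq: "nm f = nm g"
    have "isconst f m \<longrightarrow> nm f \<in> carrier M" for f m
      using nm_const[of f m] by (simp add: isconst_def)
    then consider m m' where "isconst f m" "isconst g m'"
      | "\<not> (\<exists>m. isconst f m)" "\<not> (\<exists>m. isconst g m)"
      using nm_other[of f] nm_other[of g] eq room(2) by (metis disjoint_iff)
    then show "E f g"
    proof cases
      case 1
      then show ?thesis
        using nm_const[OF 1(1)] nm_const[OF 1(2)] eq E_trans E_sym 1 unfolding isconst_def by metis
    next
      case 2
      then have "(SOME h. E f h) = (SOME h. E g h)"
        using eq by (simp add: nm_def inj_eq[OF room(1)] inj_eq[OF code])
      moreover have "E f (SOME h. E f h)" "E g (SOME h. E g h)"
        using someI[of "E f" f] someI[of "E g" g] E_refl by blast+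
      ultimately show ?thesis
        using E_trans E_sym by metis
    qed
  qed
  define N where "N = ultrapower nm M"
  have N: "is_structure N"
    unfolding N_def by (rule is_structure_ultrapower[OF M U]) (simp add: nm E_def)
  have los: "sat N (\<lambda>j. nm (e j)) \<phi> \<longleftrightarrow> eventually (\<lambda>l. sat M (\<lambda>j. e j l) \<phi>) U"
    if "\<And>j. e j \<in> UNIV \<rightarrow> carrier M" for e \<phi>
    unfolding N_def by (rule los[OF M U]) (simp_all add: nm E_def that)
  have const: "nm (\<lambda>_. m) = m" if "m \<in> carrier M" for m
    by (rule nm_const) (simp add: isconst_def E_refl that)
  have carrier: "carrier M \<subseteq> carrier N"
  proof
    fix m assume "m \<in> carrier M"
    then show "m \<in> carrier N"
      using const[of m] image_eqI[of m nm "\<lambda>_. m" "UNIV \<rightarrow> carrier M"]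
      by (simp add: N_def ultrapower_def)
  qed
  have "sat N e \<phi> \<longleftrightarrow> sat M e \<phi>" if "e \<in> UNIV \<rightarrow> carrier M" for e \<phi>
  proof -
    have "sat N (\<lambda>j. nm (\<lambda>_. e j)) \<phi> \<longleftrightarrow> eventually (\<lambda>l. sat M e \<phi>) U"
      using los[of "\<lambda>j _. e j" \<phi>] that by auto
    moreover have "(\<lambda>j. nm (\<lambda>_. e j)) = e"
      using const that by auto
    ultimately show ?thesis
      using U by (simp add: ultrafilter_def eventually_const_iff)
  qed
  then have "elementary id M N"
    using M N carrier by (auto simp: elementary_def)
  moreover have "carrier N \<subseteq> carrier M \<union> range room"
    using nm_const nm_other by (auto simp: N_def ultrapower_def isconst_def) (metis rangeE)
  moreover have "realizes N \<tau> UNIV"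
  proof -
    have "\<exists>c\<in>carrier M. \<forall>k\<in>set l. sat M ((!) (c # snd (\<tau> k))) (fst (\<tau> k))" for l
      using fin[of "set l"] by (simp add: realizes_def)
    then obtain f where f: "\<And>l. f l \<in> carrier M"
        "\<And>l k. k \<in> set l \<Longrightarrow> sat M ((!) (f l # snd (\<tau> k))) (fst (\<tau> k))"
      by metis
    have "sat N ((!) (nm f # snd (\<tau> k))) (fst (\<tau> k))" for k
    proof -
      define as where "as = snd (\<tau> k)"
      define e where "e j = (if 0 < j \<and> j < Suc (length as) then \<lambda>_. as ! (j - 1) else f)" for j
      have as: "set as \<subseteq> carrier M" "fv (fst (\<tau> k)) \<subseteq> {..<Suc (length as)}"
        using over by (auto simp: type_over_def as_def)
      have nth: "as ! i \<in> carrier M" if "i < length as" for i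
        using as(1) that by (auto simp: subset_iff)
      have e: "e j \<in> UNIV \<rightarrow> carrier M" for j
        using as(1) f(1) by (auto simp: e_def subset_iff)
      have "sat N ((!) (nm f # as)) (fst (\<tau> k)) \<longleftrightarrow> sat N (\<lambda>j. nm (e j)) (fst (\<tau> k))"
        by (rule sat_cong) (use as(2) const[OF nth] in \<open>auto simp: e_def nth_Cons split: nat.splits\<close>)
      also have "\<dots> \<longleftrightarrow> eventually (\<lambda>l. sat M (\<lambda>j. e j l) (fst (\<tau> k))) U"
        by (rule los[OF e])
      also have "\<dots>"
      proof (rule eventually_mono[OF reg[of k]])
        fix l assume "k \<in> set l"
        then have "sat M ((!) (f l # as)) (fst (\<tau> k))"
          using f(2) by (simp add: as_def)
        also have "sat M ((!) (f l # as)) (fst (\<tau> k)) \<longleftrightarrow> sat M (\<lambda>j. e j l) (fst (\<tau> k))"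
          by (rule sat_cong) (use as in \<open>auto simp: e_def nth_Cons split: nat.splits\<close>)
        finally show "sat M (\<lambda>j. e j l) (fst (\<tau> k))" .
      qed
      finally show ?thesis
        by (simp add: as_def)
    qed
    moreover have "nm f \<in> carrier N"
      using f(1) by (auto simp: N_def ultrapower_def)
    ultimately show ?thesis
      by (auto simp: realizes_def)
  qed
  ultimately show ?thesis
    by (rule that)
qed

text \<open>
  Tarski's theorem on unions of elementary chains: a witness of an existential formula in the union
  lies in a member of the chain that extends the given one.
\<close>

lemma elementary_chain:
  fixes Ms :: "('s, 'u) struct set"
  assumes "Ms \<noteq> {}"
    and chain: "\<And>M N. M \<in> Ms \<Longrightarrow> N \<in> Ms \<Longrightarrow> elementary id M N \<or> elementary id N M"
  obtains N where "carrier N = (\<Union>M\<in>Ms. carrier M)" "\<And>M. M \<in> Ms \<Longrightarrow> elementary id M N"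
proof -
  define N :: "('s, 'u) struct" where "N = \<lparr>carrier = (\<Union>M\<in>Ms. carrier M),
    interp = (\<lambda>s a. interp (SOME M. M \<in> Ms \<and> a \<in> carrier M) s a)\<rparr>"
  have str: "is_structure M" if "M \<in> Ms" for M
    using chain[OF that that] by (auto dest: elementaryD)
  have interp: "interp N s a = interp M s a" if "M \<in> Ms" "a \<in> carrier M" for M s a
  proof -
    let ?M = "SOME M. M \<in> Ms \<and> a \<in> carrier M"
    have M': "?M \<in> Ms" "a \<in> carrier ?M"
      using someI[of "\<lambda>M. M \<in> Ms \<and> a \<in> carrier M" M] that by auto
    then have "interp ?M s a = interp M s a"
      using chain[OF M'(1) that(1)] elementary_interp[of id ?M M a s]
        elementary_interp[of id M ?M a s] that(2) by auto
    then show ?thesis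
      by (simp add: N_def)
  qed
  have sub: "carrier M \<subseteq> carrier N" if "M \<in> Ms" for M
    using that by (auto simp: N_def)
  have N: "is_structure N"
    unfolding is_structure_def
  proof (intro conjI allI Pi_I)
    show "carrier N \<noteq> {}"
      using assms(1) str by (auto simp: N_def is_structure_def)
    fix s a assume "a \<in> carrier N"
    then obtain M where M: "M \<in> Ms" "a \<in> carrier M"
      by (auto simp: N_def)
    then show "interp N s a \<in> carrier N"
      using interp[OF M] str[OF M(1)] sub[OF M(1)] by (auto simp: is_structure_def)
  qed
  have trm: "trm_val N e t = trm_val M e t" if "M \<in> Ms" "e \<in> UNIV \<rightarrow> carrier M" for M e t
    using that interp trm_val_in_carrier[OF str] by (induction t) auto
  have "sat N e \<phi> \<longleftrightarrow> sat M e \<phi>" if "M \<in> Ms" "e \<in> UNIV \<rightarrow> carrier M" for M e \<phi>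
    using that
  proof (induction \<phi> arbitrary: M e)
    case (Eq t u)
    then show ?case
      by (simp add: trm)
  next
    case (Ex i \<phi>)
    show ?case
    proof
      assume "sat N e (Ex i \<phi>)"
      then obtain a where a: "a \<in> carrier N" "sat N (e(i := a)) \<phi>"
        by auto
      then obtain L where L: "L \<in> Ms" "a \<in> carrier L"
        by (auto simp: N_def)
      have "\<exists>M'\<in>Ms. elementary id M M' \<and> a \<in> carrier M'"
        using chain[OF L(1) Ex.prems(1)]
      proof
        assume "elementary id L M"
        then show ?thesis
          using L(2) Ex.prems(1) elementary_refl[OF str] elementaryD(3) by fastforce
      next
        assume "elementary id M L"
        then show ?thesis
          using L by blast
      qed
      then obtain M' where M': "M' \<in> Ms" "elementary id M M'" "a \<in> carrier M'"
        by blast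
      have e: "e \<in> UNIV \<rightarrow> carrier M'"
        using Ex.prems(2) elementaryD(3)[OF M'(2)] by (auto simp: Pi_iff)
      have "sat N (e(i := a)) \<phi> \<longleftrightarrow> sat M' (e(i := a)) \<phi>"
        by (rule Ex.IH[OF M'(1) env_upd[OF e M'(3)]])
      then have "sat M' (e(i := a)) \<phi>"
        using a(2) by blast
      then have "sat M' e (Ex i \<phi>)"
        using M'(3) by auto
      then show "sat M e (Ex i \<phi>)"
        using elementary_id_sat[OF M'(2) Ex.prems(2)] by blast
    next
      assume "sat M e (Ex i \<phi>)"
      then obtain a where a: "a \<in> carrier M" "sat M (e(i := a)) \<phi>"
        by auto
      have "sat N (e(i := a)) \<phi> \<longleftrightarrow> sat M (e(i := a)) \<phi>"
        by (rule Ex.IH[OF Ex.prems(1) env_upd[OF Ex.prems(2) a(1)]])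
      then have "sat N (e(i := a)) \<phi>"
        using a(2) by blast
      then show "sat N e (Ex i \<phi>)"
        using a(1) sub[OF Ex.prems(1)] by auto
    qed
  qed auto
  then have "elementary id M N" if "M \<in> Ms" for M
    using that N str sub[OF that] by (auto simp: elementary_def)
  then show ?thesis
    using that[of N] by (simp add: N_def)
qed

text \<open>
  Zorn's lemma is applied to pairs of an elementary extension \<open>M\<close> of \<open>M0\<close> and a set \<open>H\<close> of types
  realized in \<open>M\<close>.  The injection \<open>place\<close> reserves a set of places for each type, and the elements
  of \<open>M\<close> occupy only places reserved for types in \<open>H\<close>; hence there is always room to realize one
  more type.  In a maximal pair \<open>H\<close> therefore contains every type over \<open>M\<close> that is finitely
  satisfiable in \<open>M\<close>, so that \<open>M\<close> is saturated.  The trivial type \<open>\<tau>0\<close>, which every structure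
  realizes, provides the places of \<open>M0\<close> itself.
\<close>

lemma saturated_extension:
  fixes M0 :: "('s, 'p) struct"
    and place :: "'p \<times> (('s + nat) \<Rightarrow> 's fm \<times> 'p list) \<Rightarrow> 'p"
    and code :: "(('s + nat) list \<Rightarrow> 'p) \<Rightarrow> 'p"
  defines "\<tau>0 \<equiv> (\<lambda>_. (Eq (Var 0) (Var 0), []))"
  assumes M0: "is_structure M0" and place: "inj place" and code: "inj code"
    and M0_place: "carrier M0 \<subseteq> range (\<lambda>x. place (x, \<tau>0))"
  obtains N where "elementary id M0 N" "saturated N"
proof -
  define A where "A = {(M, H). elementary id M0 M \<and> carrier M \<subseteq> place ` (UNIV \<times> H) \<and>
    (\<forall>\<tau>\<in>H. type_over M \<tau> \<and> realizes M \<tau> UNIV)}"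
  \<comment> \<open>Structures that differ only outside their carrier are elementary substructures of each other;
    the strict growth of \<open>H\<close> makes the order antisymmetric.\<close>
  define P where "P a b \<longleftrightarrow> a = b \<or> elementary id (fst a) (fst b) \<and> snd a \<subset> snd b"
    for a b :: "('s, 'p) struct \<times> (('s + nat) \<Rightarrow> 's fm \<times> 'p list) set"
  have over_mono: "type_over N \<tau>" if "type_over M \<tau>" "elementary id M N"
    for M N :: "('s, 'p) struct" and \<tau> :: "'s + nat \<Rightarrow> 's fm \<times> 'p list"
    using that elementaryD(3)[OF that(2)] by (force simp: type_over_def)
  have "(M0, {\<tau>0}) \<in> A"
    using M0 M0_place
    by (auto simp: A_def elementary_refl type_over_def realizes_def \<tau>0_def is_structure_def)
  have "\<exists>m\<in>A. \<forall>a\<in>A. P m a \<longrightarrow> a = m"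
  proof (rule predicate_Zorn)
    show "partial_order_on A (relation_of P A)"
      by (rule partial_order_on_relation_ofI)
        (auto simp: P_def intro: elementary_id_trans)
  next
    fix C assume C: "C \<in> Chains (relation_of P A)"
    have CA: "C \<subseteq> A" and comparable: "\<And>a b. a \<in> C \<Longrightarrow> b \<in> C \<Longrightarrow> P a b \<or> P b a"
      using C by (auto simp: Chains_def relation_of_def)
    define K where "K = \<Union>(snd ` C)"
    \<comment> \<open>If \<open>K\<close> is attained in the chain, then the pair attaining it is the largest one; otherwise
      the union is strictly above all pairs.\<close>
    consider "C = {}" | a where "a \<in> C" "snd a = K" | "C \<noteq> {}" "\<And>a. a \<in> C \<Longrightarrow> snd a \<noteq> K"
      by blast
    then show "\<exists>u\<in>A. \<forall>a\<in>C. P a u"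
    proof cases
      case 1
      then show ?thesis
        using \<open>(M0, {\<tau>0}) \<in> A\<close> by blast
    next
      case 2
      have "P b a" if "b \<in> C" for b
        using comparable[OF that 2(1)] that 2 by (auto simp: P_def K_def)
      then show ?thesis
        using 2 CA by blast
    next
      case 3
      have "elementary id M M" if "M \<in> fst ` C" for M
      proof -
        have "elementary id M0 M"
          using that CA by (auto simp: A_def)
        then show ?thesis
          by (intro elementary_refl elementaryD(2))
      qed
      then have "elementary id M N \<or> elementary id N M" if "M \<in> fst ` C" "N \<in> fst ` C" for M N
        using that comparable by (fastforce simp: P_def)
      then obtain N where N: "carrier N = (\<Union>M\<in>fst ` C. carrier M)"
          "\<And>M. M \<in> fst ` C \<Longrightarrow> elementary id M N"
        using elementary_chain[of "fst ` C"] 3(1) by blast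
      have "(N, K) \<in> A"
        unfolding A_def
      proof (safe)
        obtain a where "a \<in> C"
          using 3(1) by blast
        then have "elementary id M0 (fst a)" "elementary id (fst a) N"
          using CA N(2) by (auto simp: A_def)
        then show "elementary id M0 N"
          by (rule elementary_id_trans)
      next
        fix x assume "x \<in> carrier N"
        then obtain a where "a \<in> C" "x \<in> carrier (fst a)"
          using N(1) by auto
        then show "x \<in> place ` (UNIV \<times> K)"
          using CA by (fastforce simp: A_def K_def)
      next
        fix \<tau> assume "\<tau> \<in> K"
        then obtain a where a: "a \<in> C" "\<tau> \<in> snd a"
          by (auto simp: K_def)
        then have "type_over (fst a) \<tau>" "realizes (fst a) \<tau> UNIV" "elementary id (fst a) N"
          using CA N(2) by (auto simp: A_def)
        then show "type_over N \<tau>" "realizes N \<tau> UNIV"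
          using over_mono realizes_elementary by blast+
      qed
      moreover have "P a (N, K)" if "a \<in> C" for a
        using that N(2) 3(2)[OF that] by (auto simp: P_def K_def)
      ultimately show ?thesis
        by blast
    qed
  qed
  then obtain N H where NA: "(N, H) \<in> A" and max: "\<And>a. a \<in> A \<Longrightarrow> P (N, H) a \<Longrightarrow> a = (N, H)"
    by auto
  have N: "is_structure N" "elementary id M0 N"
    using NA by (auto simp: A_def dest: elementaryD(2))
  have realized: "realizes N \<tau> UNIV"
    if over: "type_over N \<tau>" and fin: "\<And>Q. finite Q \<Longrightarrow> realizes N \<tau> Q"
    for \<tau> :: "'s + nat \<Rightarrow> 's fm \<times> 'p list"
  proof (cases "\<tau> \<in> H")
    case True
    then show ?thesis
      using NA by (auto simp: A_def)
  next
    case False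
    have room: "inj (\<lambda>x. place (x, \<tau>))" "range (\<lambda>x. place (x, \<tau>)) \<inter> carrier N = {}"
      using NA False by (auto simp: A_def inj_def inj_eq[OF place])
    obtain N' where N': "elementary id N N'"
        "carrier N' \<subseteq> carrier N \<union> range (\<lambda>x. place (x, \<tau>))" "realizes N' \<tau> UNIV"
      using extension_realizing_type[OF N(1) code room over fin] by blast
    have "elementary id M0 N'"
      using N(2) N'(1) by (rule elementary_id_trans)
    moreover have "carrier N' \<subseteq> place ` (UNIV \<times> insert \<tau> H)"
      using NA N'(2) by (fastforce simp: A_def)
    moreover have "type_over N' \<sigma>" "realizes N' \<sigma> UNIV" if "\<sigma> \<in> insert \<tau> H" for \<sigma>
    proof -
      have "\<sigma> = \<tau> \<or> type_over N \<sigma> \<and> realizes N \<sigma> UNIV"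
        using that NA by (auto simp: A_def)
      then show "type_over N' \<sigma>" "realizes N' \<sigma> UNIV"
        using N'(3) over over_mono[OF _ N'(1)] realizes_elementary[OF N'(1)] by blast+
    qed
    ultimately have "(N', insert \<tau> H) \<in> A"
      unfolding A_def by blast
    moreover have "P (N, H) (N', insert \<tau> H)"
      using False N'(1) by (auto simp: P_def)
    ultimately show ?thesis
      using max False by blast
  qed
  have "saturated N"
    unfolding saturated_def
  proof (intro allI impI)
    fix B and p :: "('s fm \<times> 'p list) set"
    assume B: "B \<subseteq> carrier N" "B \<lesssim> (UNIV :: ('s + nat) set)"
      and "(\<forall>(\<phi>, as)\<in>p. as \<in> lists B \<and> fv \<phi> \<subseteq> {..<Suc (length as)}) \<and>
        (\<forall>q\<subseteq>p. finite q \<longrightarrow> (\<exists>c\<in>carrier N. \<forall>(\<phi>, as)\<in>q. sat N ((!) (c # as)) \<phi>))"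
    then have p: "\<And>x. x \<in> p \<Longrightarrow> set (snd x) \<subseteq> B \<and> fv (fst x) \<subseteq> {..<Suc (length (snd x))}"
      and fin: "\<And>q. q \<subseteq> p \<Longrightarrow> finite q \<Longrightarrow>
        \<exists>c\<in>carrier N. \<forall>x\<in>q. sat N ((!) (c # snd x)) (fst x)"
      by (fastforce simp: case_prod_beta)+
    show "\<exists>c\<in>carrier N. \<forall>(\<phi>, as)\<in>p. sat N ((!) (c # as)) \<phi>"
    proof (cases "p = {}")
      case True
      then show ?thesis
        using N(1) by (auto simp: is_structure_def)
    next
      case False
      then obtain x0 where x0: "x0 \<in> p"
        by blast
      obtain b :: "'p \<Rightarrow> 's + nat" where b: "inj_on b B"
        using B(2) by (auto simp: lepoll_def)
      obtain pr :: "('s + nat) \<times> ('s + nat) \<Rightarrow> 's + nat" where pr: "inj pr"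
        using infinite_inj_pair[OF infinite_sum_nat] .
      obtain cl :: "('s + nat) list \<Rightarrow> 's + nat" where cl: "inj cl"
        using infinite_inj_list[OF infinite_sum_nat] .
      obtain cf :: "'s fm \<Rightarrow> 's + nat" where cf: "inj cf"
        using inj_fm .
      have "inj_on (\<lambda>x. pr (cf (fst x), cl (map b (snd x)))) p"
      proof (rule inj_onI)
        fix x y assume xy: "x \<in> p" "y \<in> p"
          "pr (cf (fst x), cl (map b (snd x))) = pr (cf (fst y), cl (map b (snd y)))"
        then have "fst x = fst y" "map b (snd x) = map b (snd y)"
          by (simp_all add: inj_eq[OF pr] inj_eq[OF cf] inj_eq[OF cl])
        moreover have "inj_on b (set (snd x) \<union> set (snd y))"
          by (rule inj_on_subset[OF b]) (use p xy in blast)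
        ultimately show "x = y"
          by (simp add: inj_on_map_eq_map prod_eq_iff)
      qed
      then have "p \<lesssim> (UNIV :: ('s + nat) set)"
        by (auto simp: lepoll_def)
      then obtain g :: "'s + nat \<Rightarrow> 's fm \<times> 'p list" where g: "p \<subseteq> range g"
        by (auto simp: lepoll_iff)
      define \<tau> where "\<tau> k = (if g k \<in> p then g k else x0)" for k
      have \<tau>: "\<tau> k \<in> p" for k
        using x0 by (simp add: \<tau>_def)
      have onto: "\<exists>k. x = \<tau> k" if "x \<in> p" for x
      proof -
        from that g obtain k where "x = g k"
          by blast
        then show ?thesis
          using that by (auto simp: \<tau>_def intro!: exI[of _ k])
      qed
      have "type_over N \<tau>"
        using p[OF \<tau>] B(1) by (auto simp: type_over_def)
      moreover have "realizes N \<tau> Q" if "finite Q" for Q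
        using fin[of "\<tau> ` Q"] that \<tau> by (auto simp: realizes_def)
      ultimately have "realizes N \<tau> UNIV"
        by (rule realized)
      then obtain c where "c \<in> carrier N" "\<And>k. sat N ((!) (c # snd (\<tau> k))) (fst (\<tau> k))"
        by (auto simp: realizes_def)
      then show ?thesis
        using onto by (metis (mono_tags, lifting) case_prod_beta)
    qed
  qed
  then show ?thesis
    using N(2) that by blast
qed

text \<open>
  With \<open>K = 's + nat\<close>, everything takes place in a set of \<open>2 ^ |K|\<close> elements: there are at most
  \<open>(2 ^ |K|) ^ |K| = 2 ^ |K|\<close> types, and as many functions from finite lists over \<open>K\<close> into the set.
\<close>

lemma saturated_elementary_extension_exists:
  fixes M :: "('s, 'm) struct"
  assumes universe: "(UNIV :: ('s + nat) set set) \<lesssim> (UNIV :: 'u set)"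
    and M: "is_structure M" "carrier M \<lesssim> (UNIV :: ('s + nat) set set)"
  obtains C :: "('s, 'u) struct" and h where "elementary h M C" "saturated C"
proof -
  have inf: "infinite (UNIV :: ('s + nat) set set)"
    using infinite_sum_nat by (simp add: Finite_Set.finite_set)
  obtain pr :: "('s + nat) set \<times> ('s + nat) set \<Rightarrow> ('s + nat) set" where pr: "inj pr"
    using infinite_inj_pair[OF inf] .
  obtain pl :: "('s + nat) set list \<Rightarrow> ('s + nat) set" where pl: "inj pl"
    using infinite_inj_list[OF inf] .
  obtain cl :: "('s + nat) list \<Rightarrow> 's + nat" where cl: "inj cl"
    using infinite_inj_list[OF infinite_sum_nat] .
  obtain cf :: "'s fm \<Rightarrow> 's + nat" where cf: "inj cf"
    using inj_fm .
  have "inj (\<lambda>(\<phi>, as). pr ({cf \<phi>}, pl as))"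
    by (auto simp: inj_def inj_eq[OF pr] inj_eq[OF cf] inj_eq[OF pl])
  then obtain ct :: "(('s + nat) \<Rightarrow> 's fm \<times> ('s + nat) set list) \<Rightarrow> ('s + nat) set"
    where ct: "inj ct"
    using infinite_inj_fun[OF infinite_sum_nat inj_on_id] by (metis id_def)
  obtain code :: "(('s + nat) list \<Rightarrow> ('s + nat) set) \<Rightarrow> ('s + nat) set" where code: "inj code"
    using infinite_inj_fun[OF infinite_sum_nat cl inj_on_id] by blast
  define place where "place = (\<lambda>(x, \<tau>). pr (x, ct \<tau>))"
  have place: "inj place"
    by (auto simp: inj_def place_def inj_eq[OF pr] inj_eq[OF ct])
  obtain f :: "'m \<Rightarrow> ('s + nat) set" where f: "inj_on f (carrier M)"
    using M(2) by (auto simp: lepoll_def)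
  define f' where "f' a = place (f a, \<lambda>_. (Eq (Var 0) (Var 0), []))" for a
  have "inj_on f' (carrier M)"
    using f by (auto simp: inj_on_def f'_def inj_eq[OF place])
  then have f': "elementary f' M (iso_image f' M)"
    by (rule elementary_iso_image[OF M(1)])
  have "carrier (iso_image f' M) \<subseteq> range (\<lambda>x. place (x, \<lambda>_. (Eq (Var 0) (Var 0), [])))"
    by (auto simp: iso_image_def f'_def)
  then obtain N where N: "elementary id (iso_image f' M) N" "saturated N"
    using saturated_extension[OF elementaryD(2)[OF f'] place code] by blast
  obtain j :: "('s + nat) set \<Rightarrow> 'u" where "inj j"
    using universe by (auto simp: lepoll_def)
  then have j: "elementary j N (iso_image j N)"
    by (intro elementary_iso_image[OF elementaryD(2)[OF N(1)]]) (auto simp: inj_on_def)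
  have "saturated (iso_image j N)"
    by (rule saturated_isomorphic[OF j _ N(2)]) (simp add: iso_image_def)
  moreover have "elementary (j \<circ> (id \<circ> f')) M (iso_image j N)"
    by (intro elementary_comp[OF _ j] elementary_comp[OF f' N(1)])
  ultimately show ?thesis
    using that by blast
qed

section \<open>Types of elements of regular acts\<close>

text \<open>
  Over a commutative monoid, \<open>has_type M a e\<close> says that \<open>a \<mapsto> e\<close> extends to an isomorphism of the
  cyclic act generated by \<open>a\<close> onto the act \<open>S e\<close>.  The idempotent \<open>e\<close> is determined by \<open>a\<close>.
\<close>

definition has_type :: "('s::monoid_mult, 'u) struct \<Rightarrow> 'u \<Rightarrow> 's \<Rightarrow> bool" where
  "has_type M a e \<longleftrightarrow>
     interp M e a = a \<and> (\<forall>s t. interp M s a = interp M t a \<longrightarrow> s * e = t * e)"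

lemma has_typeI:
  "interp M e a = a \<Longrightarrow> (\<And>s t. interp M s a = interp M t a \<Longrightarrow> s * e = t * e) \<Longrightarrow> has_type M a e"
  unfolding has_type_def by blast

lemma has_typeD:
  assumes "has_type M a e"
  shows "interp M e a = a" "\<And>s t. interp M s a = interp M t a \<Longrightarrow> s * e = t * e"
  using assms unfolding has_type_def by blast+

lemma s_actD:
  assumes "s_act M"
  shows "is_structure M" "\<And>a. a \<in> carrier M \<Longrightarrow> interp M 1 a = a"
    "\<And>s a. a \<in> carrier M \<Longrightarrow> interp M s a \<in> carrier M"
    "\<And>s t a. a \<in> carrier M \<Longrightarrow> interp M s (interp M t a) = interp M (s * t) a"
  using assms by (auto simp: s_act_def is_structure_def)

lemma has_type_idempotent:
  assumes "s_act M" "a \<in> carrier M" "has_type M a e"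
  shows "e * e = e"
proof -
  have "interp M e a = interp M 1 a"
    using has_typeD(1)[OF assms(3)] s_actD(2)[OF assms(1,2)] by simp
  then have "e * e = 1 * e"
    by (rule has_typeD(2)[OF assms(3)])
  then show ?thesis
    by simp
qed

lemma act_regular_iff_has_type:
  assumes M: "s_act M" and a: "a \<in> carrier M"
  shows "act_regular M a \<longleftrightarrow> (\<exists>e. has_type M a e)"
proof
  assume "act_regular M a"
  then obtain f where f: "f \<in> act_hom (cyclic M a) self_act" "interp M (f a) a = a"
    by (auto simp: act_regular_def)
  have hom: "f (interp M s (interp M t a)) = s * f (interp M t a)" for s t
    using f(1) by (auto simp: act_hom_def cyclic_def self_act_def)
  have "f (interp M s a) = s * f a" for s
    using hom[of s 1] s_actD(2)[OF M a] by simp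
  then have "s * f a = t * f a" if "interp M s a = interp M t a" for s t
    using that by metis
  then have "has_type M a (f a)"
    using f(2) by (intro has_typeI)
  then show "\<exists>e. has_type M a e" ..
next
  assume "\<exists>e. has_type M a e"
  then obtain e where "has_type M a e"
    by blast
  note e = has_typeD[OF this]
  define q where "q b = (SOME s. interp M s a = b)" for b
  have q: "interp M (q (interp M s a)) a = interp M s a" for s
    unfolding q_def by (rule someI) (rule refl)
  define f where "f b = q b * e" for b
  have f: "f (interp M s a) = s * e" for s
    unfolding f_def by (rule e(2)[OF q])
  have "f \<in> act_hom (cyclic M a) self_act"
    by (auto simp: act_hom_def cyclic_def self_act_def s_actD(4)[OF M a] f mult.assoc)
  moreover have "interp M (f a) a = a"
  proof -
    have "e * e = e"
      by (rule has_type_idempotent[OF M a \<open>has_type M a e\<close>])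
    then have "f a = e"
      using f[of e] e(1) by simp
    then show ?thesis
      using e(1) by simp
  qed
  ultimately show "act_regular M a"
    by (auto simp: act_regular_def)
qed

lemma regular_act_iff_has_type:
  "regular_act M \<longleftrightarrow> s_act M \<and> (\<forall>a\<in>carrier M. \<exists>e. has_type M a e)"
  by (metis act_regular_iff_has_type regular_act_def)

lemma regular_act_has_type:
  assumes "regular_act M" "a \<in> carrier M"
  obtains e where "has_type M a e"
  using assms unfolding regular_act_iff_has_type by blast

lemma isomorphism_regular_act:
  assumes M: "regular_act M" and inj: "inj_on h (carrier M)" and N: "carrier N = h ` carrier M"
    and hom: "\<And>s a. a \<in> carrier M \<Longrightarrow> interp N s (h a) = h (interp M s a)"
  shows "regular_act N"
proof -
  have M': "s_act M"
    using M by (simp add: regular_act_def)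
  have "is_structure N"
    by (rule isomorphism_is_structure[OF s_actD(1)[OF M'] N hom])
  then have "s_act N"
    by (simp add: s_act_def N hom s_actD(2,3,4)[OF M'])
  moreover have "has_type N (h a) e" if "a \<in> carrier M" "has_type M a e" for a e
  proof -
    have "interp N s (h a) = interp N t (h a) \<longleftrightarrow> interp M s a = interp M t a" for s t
      by (simp only: hom[OF that(1)] inj_on_eq_iff[OF inj s_actD(3)[OF M' that(1)]
          s_actD(3)[OF M' that(1)]])
    then have "s * e = t * e" if "interp N s (h a) = interp N t (h a)" for s t
      using has_typeD(2)[OF \<open>has_type M a e\<close>] that by blast
    moreover have "interp N e (h a) = h a"
      by (simp only: hom[OF that(1)] has_typeD(1)[OF that(2)])
    ultimately show ?thesis
      by (intro has_typeI)
  qed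
  ultimately show ?thesis
    using M unfolding regular_act_iff_has_type N by blast
qed

text \<open>The idempotents \<open>e\<close> for which the act \<open>S e\<close> is regular.\<close>

definition regular_idempotent :: "'s::comm_monoid_mult \<Rightarrow> bool" where
  "regular_idempotent e \<longleftrightarrow> e * e = e \<and> (\<forall>s. \<exists>g. has_type self_act (s * e) g)"

lemma regular_idempotent_of_type:
  fixes M :: "('s::comm_monoid_mult, 'u) struct"
  assumes M: "regular_act M" and a: "a \<in> carrier M" and e: "has_type M a e"
  shows "regular_idempotent e"
proof -
  have act: "s_act M"
    using M by (simp add: regular_act_def)
  have "\<exists>g. has_type self_act (s * e) g" for s
  proof -
    obtain g where g: "has_type M (interp M s a) g"
      using regular_act_has_type[OF M s_actD(3)[OF act a]] .
    have eq: "interp M t a = interp M u a \<longleftrightarrow> t * e = u * e" for t u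
    proof
      assume "t * e = u * e"
      then have "interp M t (interp M e a) = interp M u (interp M e a)"
        by (simp add: s_actD(4)[OF act a])
      then show "interp M t a = interp M u a"
        by (simp add: has_typeD(1)[OF e])
    qed (rule has_typeD(2)[OF e])
    have "has_type self_act (s * e) g"
    proof (rule has_typeI)
      have "interp M (g * s) a = interp M s a"
        using has_typeD(1)[OF g] by (simp add: s_actD(4)[OF act a])
      then show "interp self_act g (s * e) = s * e"
        by (simp add: eq self_act_def mult.assoc)
      show "t * g = u * g" if "interp self_act t (s * e) = interp self_act u (s * e)" for t u
        by (rule has_typeD(2)[OF g])
          (use that in \<open>simp add: eq self_act_def mult.assoc s_actD(4)[OF act a]\<close>)
    qed
    then show ?thesis ..
  qed
  then show ?thesis
    using has_type_idempotent[OF act a e] by (simp add: regular_idempotent_def)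
qed

lemma regular_idempotent_mult:
  assumes "regular_idempotent e" "regular_idempotent f"
  shows "regular_idempotent (e * f)"
proof -
  have "e * f * (e * f) = (e * e) * (f * f)"
    by (simp only: ac_simps)
  moreover have "\<exists>g. has_type self_act (s * (e * f)) g" for s
  proof -
    have "s * (e * f) = s * f * e"
      by (simp only: ac_simps)
    then show ?thesis
      using assms(1) unfolding regular_idempotent_def by metis
  qed
  ultimately show ?thesis
    using assms by (simp add: regular_idempotent_def)
qed

section \<open>Amalgams of three cyclic acts\<close>

text \<open>
  Cyclic acts \<open>S (\<epsilon> 1)\<close> and \<open>S (\<epsilon> 2)\<close> are glued to \<open>S (\<epsilon> 0)\<close> along common ideals \<open>N1\<close> and \<open>N2\<close>.
  The element \<open>a\<close> of the \<open>j\<close>-th act is represented by \<open>glue N1 N2 j a\<close>, whose second component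
  is always \<open>a\<close>; therefore the second projection is a homomorphism into the monoid.
\<close>

definition glue :: "'s set \<Rightarrow> 's set \<Rightarrow> nat \<Rightarrow> 's \<Rightarrow> nat \<times> 's" where
  "glue N1 N2 j a = (if j = 1 \<and> a \<notin> N1 \<or> j = 2 \<and> a \<notin> N2 then (j, a) else (0, a))"

definition amalgam ::
    "'s set \<Rightarrow> 's set \<Rightarrow> (nat \<Rightarrow> 's) \<Rightarrow> ('s::comm_monoid_mult, nat \<times> 's) struct" where
  "amalgam N1 N2 \<epsilon> = \<lparr>carrier = {glue N1 N2 j (s * \<epsilon> j) | j s. True},
     interp = (\<lambda>r (j, a). glue N1 N2 j (r * a))\<rparr>"

lemma interp_amalgam_glue:
  assumes "\<And>r a. a \<in> N1 \<Longrightarrow> r * a \<in> N1" "\<And>r a. a \<in> N2 \<Longrightarrow> r * a \<in> N2"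
  shows "interp (amalgam N1 N2 \<epsilon>) r (glue N1 N2 j a) = glue N1 N2 j (r * a)"
  using assms by (auto simp: amalgam_def glue_def)

lemma regular_act_amalgam:
  assumes N: "\<And>r a. a \<in> N1 \<Longrightarrow> r * a \<in> N1" "\<And>r a. a \<in> N2 \<Longrightarrow> r * a \<in> N2"
    and \<epsilon>: "\<And>j. regular_idempotent (\<epsilon> j)"
  shows "regular_act (amalgam N1 N2 \<epsilon>)"
proof -
  let ?D = "amalgam N1 N2 \<epsilon>"
  have interp: "interp ?D r (glue N1 N2 j a) = glue N1 N2 j (r * a)" for r j a
    by (rule interp_amalgam_glue[OF N])
  have carrier: "carrier ?D = {glue N1 N2 j (s * \<epsilon> j) | j s. True}"
    by (simp add: amalgam_def)
  have eq: "glue N1 N2 j a = glue N1 N2 j b \<longleftrightarrow> a = b" for j a b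
    by (auto simp: glue_def)
  have "glue N1 N2 j (r * (s * \<epsilon> j)) \<in> carrier ?D" for j r s
    by (auto simp: carrier mult.assoc[symmetric])
  moreover have "carrier ?D \<noteq> {}"
    unfolding carrier by blast
  ultimately have "s_act ?D"
    unfolding s_act_def is_structure_def by (auto simp: carrier interp mult.assoc)
  moreover have "\<exists>g. has_type ?D (glue N1 N2 j (s * \<epsilon> j)) g" for j s
  proof -
    obtain g where "has_type self_act (s * \<epsilon> j) g"
      using \<epsilon> unfolding regular_idempotent_def by blast
    then have "has_type ?D (glue N1 N2 j (s * \<epsilon> j)) g"
      unfolding has_type_def interp eq self_act_def struct.simps .
    then show ?thesis ..
  qed
  ultimately show ?thesis
    by (auto simp: regular_act_iff_has_type carrier)
qed

section \<open>Consequences of primitive normality\<close>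

lemma sat_sentence: "\<sigma> \<in> sentences \<Longrightarrow> sat M e \<sigma> \<longleftrightarrow> sat M e' \<sigma>"
  by (rule sat_cong) (simp add: sentences_def)

text \<open>
  The theory of \<open>D\<close> is a completion of the theory of regular acts, and a saturated elementary
  extension of \<open>D\<close> is one of its large models.  Primitive normality is a first-order property, so it
  descends to \<open>D\<close>.
\<close>

lemma primitive_normal_in_regular_act:
  fixes D :: "('s::comm_monoid_mult, 'm) struct"
  assumes universe: "(UNIV :: ('s + nat) set set) \<lesssim> (UNIV :: 'u set)"
    and normal: "primitive_normal_class (regular_acts :: ('s, 'u) struct set)"
    and D: "regular_act D" "carrier D \<lesssim> (UNIV :: ('s + nat) set set)"
    and \<Phi>: "primitive \<Phi>" "fv \<Phi> \<subseteq> {..<1 + 1}"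
    and carrier: "{x, x', y, y'} \<subseteq> carrier D"
    and sat: "holds D \<Phi> [x, y]" "holds D \<Phi> [x, y']" "holds D \<Phi> [x', y]"
  shows "holds D \<Phi> [x', y']"
proof -
  have str: "is_structure D"
    using D(1) by (simp add: regular_act_def s_act_def)
  obtain C :: "('s, 'u) struct" and h where h: "elementary h D C" and C: "saturated C"
    using saturated_elementary_extension_exists[OF universe str D(2)] .
  define T where "T = {\<sigma> \<in> sentences. models C {\<sigma>}}"
  have C_models: "models C T"
    using elementaryD(2)[OF h] by (auto simp: T_def models_def)
  obtain a where a: "a \<in> carrier D"
    using str by (auto simp: is_structure_def)
  have T_iff: "\<sigma> \<in> T \<longleftrightarrow> sat C (\<lambda>_. h a) \<sigma>" if "\<sigma> \<in> sentences" for \<sigma>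
    using elementaryD(2,3)[OF h] a sat_sentence[OF that] that
    by (auto simp: T_def models_def Pi_iff)
  \<comment> \<open>The isomorphic copy of \<open>D\<close> in \<open>C\<close> is a member of the class.\<close>
  define D' where "D' = \<lparr>carrier = h ` carrier D, interp = interp C\<rparr>"
  have D': "elementary h D D'" "regular_act D'"
    using isomorphism_elementary[OF str elementary_inj_on[OF h], of D']
      isomorphism_regular_act[OF D(1) elementary_inj_on[OF h], of D']
      elementary_interp[OF h] by (simp_all add: D'_def)
  have "theory_of (regular_acts :: ('s, 'u) struct set) \<subseteq> T"
  proof
    fix \<sigma> :: "'s fm" assume \<sigma>: "\<sigma> \<in> theory_of (regular_acts :: ('s, 'u) struct set)"
    then have "\<sigma> \<in> sentences" "models D' {\<sigma>}"
      using D'(2) by (auto simp: theory_of_def regular_acts_def)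
    moreover have "h a \<in> carrier D'"
      using a by (simp add: D'_def)
    ultimately have "sat D' (h \<circ> (\<lambda>_. a)) \<sigma>"
      by (auto simp: models_def)
    then have "sat C (h \<circ> (\<lambda>_. a)) \<sigma>"
      using elementaryD(4)[OF h, of "\<lambda>_. a" \<sigma>] elementaryD(4)[OF D'(1), of "\<lambda>_. a" \<sigma>] a by simp
    then show "\<sigma> \<in> T"
      using T_iff[OF \<open>\<sigma> \<in> sentences\<close>] by (simp add: comp_def)
  qed
  moreover have "complete_theory TYPE('u) T"
    unfolding complete_theory_def
  proof (intro conjI ballI)
    show "T \<subseteq> sentences"
      by (auto simp: T_def)
    show "\<exists>M :: ('s, 'u) struct. models M T"
      using C_models ..
    fix \<sigma> :: "'s fm" assume \<sigma>: "\<sigma> \<in> sentences"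
    then have "Neg \<sigma> \<in> sentences"
      by (simp add: sentences_def)
    then show "\<sigma> \<in> T \<or> Neg \<sigma> \<in> T"
      using \<sigma> by (simp add: T_iff)
  qed
  ultimately have "primitive_normal TYPE('u) T"
    using normal by (simp add: primitive_normal_class_def completion_def)
  moreover have "monster T C"
    using C_models C by (simp add: monster_def)
  moreover define X where "X = defset C 1 \<Phi> [h y]"
  moreover define Y where "Y = defset C 1 \<Phi> [h y']"
  moreover have h_in: "{h x, h x', h y, h y'} \<subseteq> carrier C"
    using carrier elementaryD(3)[OF h] by auto
  then have "primitive_copies C 1 X Y"
    unfolding primitive_copies_def X_def Y_def
    by (intro exI[of _ \<Phi>] exI[of _ 1] bexI[of _ "[h y]"] bexI[of _ "[h y']"])
      (use \<Phi> in \<open>auto simp: tuples_def\<close>)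
  ultimately have XY: "X = Y \<or> X \<inter> Y = {}"
    unfolding primitive_normal_def by blast
  have holds: "holds C \<Phi> [h u, h v] \<longleftrightarrow> holds D \<Phi> [u, v]"
    if "u \<in> carrier D" "v \<in> carrier D" for u v
    using elementary_sat_list[OF h, of "[u, v]" \<Phi>] that \<Phi>(2) by (simp add: holds_def)
  have "[h x] \<in> X" "[h x] \<in> Y" "[h x'] \<in> X"
    using sat holds h_in carrier by (auto simp: X_def Y_def defset_def tuples_def)
  then have "[h x'] \<in> Y"
    using XY by blast
  then show ?thesis
    using holds carrier by (auto simp: Y_def defset_def)
qed

text \<open>
  Let \<open>w0\<close>, \<open>w1\<close>, \<open>w2\<close> be the generators of the amalgam in which \<open>t w1\<close> is glued to \<open>t w0\<close> and
  \<open>s w2\<close> to \<open>s w0\<close>.  The formula \<open>\<exists>w. s w = x \<and> t w = y\<close> holds of \<open>(s w0, t w0)\<close>, of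
  \<open>(s w0, t w2)\<close> and of \<open>(s w1, t w0)\<close>, hence by primitive normality of \<open>(s w1, t w2)\<close>.  But an
  element \<open>w\<close> with \<open>s w = s w1\<close> and \<open>t w = t w2\<close> exists only if one of these points lies in the
  glued part.
\<close>

lemma amalgam_dichotomy:
  fixes e0 e1 e2 s t :: "'s::comm_monoid_mult"
  assumes universe: "(UNIV :: ('s + nat) set set) \<lesssim> (UNIV :: 'u set)"
    and normal: "primitive_normal_class (regular_acts :: ('s, 'u) struct set)"
    and reg: "regular_idempotent e0" "regular_idempotent e1" "regular_idempotent e2"
    and t: "t * e0 = t * e1" and s: "s * e0 = s * e2"
  shows "(\<exists>r. s * e1 = r * (t * e1)) \<or> (\<exists>r. t * e2 = r * (s * e2))"
proof (rule ccontr)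
  define N1 where "N1 = {r * (t * e1) | r. True}"
  define N2 where "N2 = {r * (s * e2) | r. True}"
  define \<epsilon> where "\<epsilon> j = (if j = 1 then e1 else if j = 2 then e2 else e0)" for j :: nat
  define D where "D = amalgam N1 N2 \<epsilon>"
  assume "\<not> ?thesis"
  then have notin: "s * e1 \<notin> N1" "t * e2 \<notin> N2"
    by (auto simp: N1_def N2_def)
  have mem: "t * e1 \<in> N1" "s * e2 \<in> N2"
    unfolding N1_def N2_def by (metis (mono_tags, lifting) mem_Collect_eq mult_1_left)+
  have ideal: "r * a \<in> N1" if "a \<in> N1" for r a
    using that unfolding N1_def by (auto simp: mult.assoc[symmetric])
  have ideal': "r * a \<in> N2" if "a \<in> N2" for r a
    using that unfolding N2_def by (auto simp: mult.assoc[symmetric])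
  have D: "regular_act D"
    unfolding D_def by (rule regular_act_amalgam) (use ideal ideal' reg in \<open>auto simp: \<epsilon>_def\<close>)
  have interp: "interp D r (glue N1 N2 j a) = glue N1 N2 j (r * a)" for r j a
    unfolding D_def by (rule interp_amalgam_glue) (use ideal ideal' in auto)
  have "inj (\<lambda>(n, a). {Inr n, Inl a} :: ('s + nat) set)"
    by (auto simp: inj_def doubleton_eq_iff)
  then have card: "carrier D \<lesssim> (UNIV :: ('s + nat) set set)"
    by (metis inj_on_subset lepoll_def subset_UNIV)
  define w where "w j = glue N1 N2 j (\<epsilon> j)" for j
  have w: "w j \<in> carrier D" for j
    unfolding w_def D_def amalgam_def by simp (metis mult_1_left)
  have act: "interp D r (w j) \<in> carrier D" for r j
    using D s_actD(3)[OF _ w] by (simp add: regular_act_def)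
  define \<Phi> :: "'s fm" where
    "\<Phi> = Ex 2 (And (Eq (App s (Var 2)) (Var 0)) (Eq (App t (Var 2)) (Var 1)))"
  have prim: "primitive \<Phi>"
    unfolding primitive_def \<Phi>_def
    by (intro exI[of _ "[2]"] exI[of _ "[Eq (App s (Var 2)) (Var 0)]"]
        exI[of _ "Eq (App t (Var 2)) (Var 1)"]) (simp add: atomic_def)
  have fv: "fv \<Phi> \<subseteq> {..<1 + 1}"
    by (auto simp: \<Phi>_def)
  have holds_iff: "holds D \<Phi> [x, y] \<longleftrightarrow> (\<exists>u\<in>carrier D. interp D s u = x \<and> interp D t u = y)"
    for x y
    by (simp add: holds_def \<Phi>_def)
  have glued: "interp D t (w 1) = interp D t (w 0)" "interp D s (w 2) = interp D s (w 0)"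
    using mem t s by (simp_all add: w_def interp) (simp_all add: glue_def \<epsilon>_def)
  have "holds D \<Phi> [interp D s (w 0), interp D t (w 0)]"
    unfolding holds_iff by (rule bexI[of _ "w 0"]) (simp_all add: w)
  moreover have "holds D \<Phi> [interp D s (w 0), interp D t (w 2)]"
    unfolding holds_iff by (rule bexI[of _ "w 2"]) (simp_all add: w glued)
  moreover have "holds D \<Phi> [interp D s (w 1), interp D t (w 0)]"
    unfolding holds_iff by (rule bexI[of _ "w 1"]) (simp_all add: w glued del: One_nat_def)
  moreover have
    "{interp D s (w 0), interp D s (w 1), interp D t (w 0), interp D t (w 2)} \<subseteq> carrier D"
    by (simp add: act)
  ultimately have "holds D \<Phi> [interp D s (w 1), interp D t (w 2)]"
    using primitive_normal_in_regular_act[OF universe normal D card prim fv,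
        of "interp D s (w 0)" "interp D s (w 1)" "interp D t (w 0)" "interp D t (w 2)"] by simp
  then obtain u where u: "u \<in> carrier D"
      "interp D s u = interp D s (w 1)" "interp D t u = interp D t (w 2)"
    unfolding holds_iff by blast
  obtain j a where ja: "u = glue N1 N2 j a"
    using u(1) by (auto simp: D_def amalgam_def)
  have "glue N1 N2 j (s * a) = (1, s * e1)"
    using u(2) notin(1) by (simp add: ja w_def interp \<epsilon>_def) (simp add: glue_def)
  moreover have "glue N1 N2 j (t * a) = (2, t * e2)"
    using u(3) notin(2) by (simp add: ja w_def interp \<epsilon>_def) (simp add: glue_def)
  ultimately show False
    by (auto simp: glue_def split: if_splits)
qed

text \<open>
  The acts \<open>S e\<close> and \<open>S f\<close> are glued along \<open>S (e f)\<close>, which is contained in both of them and serves as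
  the central act of the amalgam.
\<close>

lemma regular_idempotents_chain:
  fixes e f :: "'s::comm_monoid_mult"
  assumes universe: "(UNIV :: ('s + nat) set set) \<lesssim> (UNIV :: 'u set)"
    and normal: "primitive_normal_class (regular_acts :: ('s, 'u) struct set)"
    and reg: "regular_idempotent e" "regular_idempotent f"
  shows "e * f = e \<or> e * f = f"
proof -
  have e: "e * e = e" and f: "f * f = f"
    using reg by (auto simp: regular_idempotent_def)
  have "f * (e * f) = (f * f) * e" "e * (e * f) = (e * e) * f"
    by (simp_all only: ac_simps)
  then have "f * (e * f) = f * e" "e * (e * f) = e * f"
    by (simp_all only: e f)
  then consider r where "e * e = r * (f * e)" | r where "f * f = r * (e * f)"
    using amalgam_dichotomy[OF universe normal regular_idempotent_mult[OF reg] reg, of f e] by blast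
  then show ?thesis
  proof cases
    case 1
    then have r: "e = r * (f * e)"
      using e by (rule trans[OF sym, rotated])
    have "r * ((f * f) * e) = e"
      unfolding f by (rule r[symmetric])
    also have "r * ((f * f) * e) = r * (f * e) * f"
      by (simp only: ac_simps)
    finally have "e = e * f"
      unfolding r[symmetric] by (rule sym)
    then show ?thesis
      by simp
  next
    case 2
    then have r: "f = r * (e * f)"
      using f by (rule trans[OF sym, rotated])
    have "r * ((e * e) * f) = f"
      unfolding e by (rule r[symmetric])
    also have "r * ((e * e) * f) = e * (r * (e * f))"
      by (simp only: ac_simps)
    finally have "f = e * f"
      unfolding r[symmetric] by (rule sym)
    then show ?thesis
      by simp
  qed
qed

text \<open>
  The largest of the idempotents of \<open>x\<close>, \<open>y\<close>, \<open>z\<close> fixes all three elements, so that one divisibility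
  among its multiples serves \<open>x\<close>, \<open>y\<close> and \<open>z\<close> simultaneously.
\<close>

lemma comparable_on_triples:
  fixes M :: "('s::comm_monoid_mult, 'v) struct"
  assumes universe: "(UNIV :: ('s + nat) set set) \<lesssim> (UNIV :: 'u set)"
    and normal: "primitive_normal_class (regular_acts :: ('s, 'u) struct set)"
    and M: "regular_act M" and xyz: "{x, y, z} \<subseteq> carrier M"
  shows "\<exists>r. (\<forall>v\<in>{x, y, z}. interp M p v = interp M (r * q) v) \<or>
    (\<forall>v\<in>{x, y, z}. interp M q v = interp M (r * p) v)"
proof -
  have act: "s_act M"
    using M by (simp add: regular_act_def)
  obtain ex ey ez where e: "has_type M x ex" "has_type M y ey" "has_type M z ez"
    using xyz M unfolding regular_act_iff_has_type by (metis insert_subset)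
  then have reg: "regular_idempotent ex" "regular_idempotent ey" "regular_idempotent ez"
    using regular_idempotent_of_type[OF M] xyz by auto
  have upper_bound: "\<exists>m. regular_idempotent m \<and> a * m = a \<and> b * m = b"
    if "regular_idempotent a" "regular_idempotent b" for a b :: 's
    using regular_idempotents_chain[OF universe normal that]
  proof
    assume "a * b = a"
    then show ?thesis
      using that by (intro exI[of _ b]) (simp add: regular_idempotent_def)
  next
    assume "a * b = b"
    then show ?thesis
      using that by (intro exI[of _ a]) (simp add: regular_idempotent_def mult.commute)
  qed
  obtain m' where m': "regular_idempotent m'" "ex * m' = ex" "ey * m' = ey"
    using upper_bound[OF reg(1,2)] by blast
  obtain m where m: "regular_idempotent m" "m' * m = m'" "ez * m = ez"
    using upper_bound[OF m'(1) reg(3)] by blast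
  have "ex * m' * m = ex * m'" "ey * m' * m = ey * m'"
    by (simp_all only: mult.assoc m(2))
  then have below: "ex * m = ex" "ey * m = ey" "ez * m = ez"
    by (simp_all only: m' m(3))
  have fixed: "interp M m v = v" if "v \<in> carrier M" "has_type M v e" "e * m = e" for v e
  proof -
    have "interp M m (interp M e v) = interp M (e * m) v"
      by (simp only: s_actD(4)[OF act that(1)] mult.commute)
    then show ?thesis
      by (simp only: that(3) has_typeD(1)[OF that(2)])
  qed
  have le: "interp M b v = interp M (r * c) v"
    if "b * m = r * (c * m)" "v \<in> {x, y, z}" for b c r v
  proof -
    have v: "v \<in> carrier M" "interp M m v = v"
      using that(2) xyz fixed[OF _ e(1) below(1)] fixed[OF _ e(2) below(2)]
        fixed[OF _ e(3) below(3)] by auto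
    have "interp M (b * m) v = interp M (r * c * m) v"
      using that(1) by (simp add: mult.assoc)
    then show ?thesis
      using v s_actD(4)[OF act v(1), of b m] s_actD(4)[OF act v(1), of "r * c" m] by simp
  qed
  have "(\<exists>r. p * m = r * (q * m)) \<or> (\<exists>r. q * m = r * (p * m))"
    by (rule amalgam_dichotomy[OF universe normal m(1) m(1) m(1)]) (rule refl)+
  then show ?thesis
    using le by metis
qed

section \<open>A majority operation\<close>

definition coincidence :: "('s, 'u) struct \<Rightarrow> 'u \<Rightarrow> 'u \<Rightarrow> 's set" where
  "coincidence M x y = {s. interp M s x = interp M s y}"

definition majority :: "('s, 'u) struct \<Rightarrow> 'u \<Rightarrow> 'u \<Rightarrow> 'u \<Rightarrow> 'u" where
  "majority M x y z = (if coincidence M x y \<subset> coincidence M y z then y else x)"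

lemma majority_in: "majority M x y z \<in> {x, y}"
  by (simp add: majority_def)

lemma majority_simps:
  shows "majority M x x z = x" "majority M x y x = x"
    and "s_act M \<Longrightarrow> x \<in> carrier M \<Longrightarrow> y \<in> carrier M \<Longrightarrow> majority M x y y = y"
proof -
  show "majority M x x z = x"
    by (simp add: majority_def)
  have "coincidence M x y = coincidence M y x"
    by (auto simp: coincidence_def)
  then show "majority M x y x = x"
    by (simp add: majority_def)
  assume "s_act M" "x \<in> carrier M" "y \<in> carrier M"
  then have "1 \<in> coincidence M x y \<longleftrightarrow> x = y"
    by (simp add: coincidence_def s_actD(2))
  then show "majority M x y y = y"
    by (auto simp: majority_def coincidence_def)
qed

text \<open>
  For an ideal \<open>I\<close> let \<open>I : s = {r. r s \<in> I}\<close>; then \<open>I (s x) (s y) = I x y : s\<close>.  By comparability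
  the ideals \<open>I x y\<close> and \<open>I y z\<close> form a chain, and passing to \<open>I : s\<close> preserves inclusion.  The
  choice between \<open>x\<close> and \<open>y\<close> could only change if a strict inclusion became an equality.  For
  \<open>q\<close> in \<open>I y z\<close> but not in \<open>I x y\<close>, either \<open>q\<close> acts as \<open>r s\<close>, and \<open>r\<close> witnesses that the inclusion
  remains strict, or \<open>s\<close> acts as a multiple of \<open>q\<close>, so that \<open>s y = s z\<close>; then \<open>1\<close> is such a witness
  unless \<open>s x = s y\<close>, when the choice is immaterial.
\<close>

lemma majority_interp:
  fixes M :: "('s::comm_monoid_mult, 'u) struct"
  assumes M: "s_act M" and xyz: "{x, y, z} \<subseteq> carrier M"
    and comparable: "\<And>p q. \<exists>r. (\<forall>v\<in>{x, y, z}. interp M p v = interp M (r * q) v) \<or>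
      (\<forall>v\<in>{x, y, z}. interp M q v = interp M (r * p) v)"
  shows "majority M (interp M s x) (interp M s y) (interp M s z) = interp M s (majority M x y z)"
proof -
  let ?I = "coincidence M x y" and ?J = "coincidence M y z"
  let ?I' = "coincidence M (interp M s x) (interp M s y)"
  let ?J' = "coincidence M (interp M s y) (interp M s z)"
  have colon: "r \<in> ?I' \<longleftrightarrow> r * s \<in> ?I" "r \<in> ?J' \<longleftrightarrow> r * s \<in> ?J" for r
    using xyz by (auto simp: coincidence_def s_actD(4)[OF M])
  have ideal: "r * q \<in> ?I" if "q \<in> ?I" for r q
    using that xyz by (simp add: coincidence_def flip: s_actD(4)[OF M])
  have ideal': "r * q \<in> ?J" if "q \<in> ?J" for r q
    using that xyz by (simp add: coincidence_def flip: s_actD(4)[OF M])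
  have same: "p \<in> ?I \<longleftrightarrow> q \<in> ?I" "p \<in> ?J \<longleftrightarrow> q \<in> ?J"
    if "\<forall>v\<in>{x, y, z}. interp M p v = interp M q v" for p q
    using that by (auto simp: coincidence_def)
  have "?I \<subset> ?J \<or> ?J \<subseteq> ?I"
  proof (rule ccontr)
    assume "\<not> ?thesis"
    then obtain p q where "p \<in> ?I" "p \<notin> ?J" "q \<in> ?J" "q \<notin> ?I"
      by blast
    then show False
      using comparable[of p q] same ideal ideal' by meson
  qed
  then show ?thesis
  proof
    assume IJ: "?I \<subset> ?J"
    show ?thesis
    proof (cases "interp M s x = interp M s y")
      case True
      then show ?thesis
        using IJ by (simp add: majority_def)
    next
      case False
      obtain q where q: "q \<in> ?J" "q \<notin> ?I"
        using IJ by blast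
      have "\<exists>r. r \<in> ?J' \<and> r \<notin> ?I'"
      proof -
        obtain r where "(\<forall>v\<in>{x, y, z}. interp M s v = interp M (r * q) v) \<or>
            (\<forall>v\<in>{x, y, z}. interp M q v = interp M (r * s) v)"
          using comparable[of s q] by blast
        then show ?thesis
        proof
          assume "\<forall>v\<in>{x, y, z}. interp M s v = interp M (r * q) v"
          then have "s \<in> ?J"
            using same(2) ideal'[OF q(1)] by blast
          moreover have "s \<notin> ?I"
            using False by (simp add: coincidence_def)
          ultimately show ?thesis
            using colon[of 1] by auto
        next
          assume "\<forall>v\<in>{x, y, z}. interp M q v = interp M (r * s) v"
          then show ?thesis
            using same q colon[of r] by blast
        qed
      qed
      then have "?I' \<subset> ?J'"
        using IJ colon by blast
      then show ?thesis
        using IJ by (simp add: majority_def)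
    qed
  next
    assume "?J \<subseteq> ?I"
    then have "\<not> ?I \<subset> ?J" "\<not> ?I' \<subset> ?J'"
      using colon by blast+
    then show ?thesis
      by (simp add: majority_def)
  qed
qed

definition polymorphism :: "('s, 'u) struct \<Rightarrow> ('u \<Rightarrow> 'u \<Rightarrow> 'u \<Rightarrow> 'u) \<Rightarrow> bool" where
  "polymorphism M m \<longleftrightarrow> (\<forall>x\<in>carrier M. \<forall>y\<in>carrier M. \<forall>z\<in>carrier M. m x y z \<in> carrier M \<and>
     (\<forall>s. m (interp M s x) (interp M s y) (interp M s z) = interp M s (m x y z)))"

lemma polymorphism_primitive:
  assumes M: "is_structure M" and m: "polymorphism M m"
    and "primitive \<phi>"
    and "e1 \<in> UNIV \<rightarrow> carrier M" "e2 \<in> UNIV \<rightarrow> carrier M" "e3 \<in> UNIV \<rightarrow> carrier M"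
    and "sat M e1 \<phi>" "sat M e2 \<phi>" "sat M e3 \<phi>"
  shows "sat M (\<lambda>i. m (e1 i) (e2 i) (e3 i)) \<phi>"
proof -
  obtain xs \<phi>s \<phi>0 where atoms: "\<forall>\<psi>\<in>set \<phi>s. atomic \<psi>" "atomic \<phi>0"
    and \<phi>: "\<phi> = foldr Ex xs (foldr And \<phi>s \<phi>0)"
    using \<open>primitive \<phi>\<close> by (auto simp: primitive_def)
  have trm: "trm_val M (\<lambda>i. m (e1 i) (e2 i) (e3 i)) t =
      m (trm_val M e1 t) (trm_val M e2 t) (trm_val M e3 t)"
    if "e1 \<in> UNIV \<rightarrow> carrier M" "e2 \<in> UNIV \<rightarrow> carrier M" "e3 \<in> UNIV \<rightarrow> carrier M" for t e1 e2 e3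
  proof (induction t)
    case (App s t)
    have "{trm_val M e1 t, trm_val M e2 t, trm_val M e3 t} \<subseteq> carrier M"
      using trm_val_in_carrier[OF M] that by blast
    then show ?case
      using m by (simp add: App polymorphism_def)
  qed simp
  have conj: "sat M (\<lambda>i. m (e1 i) (e2 i) (e3 i)) (foldr And \<phi>s \<phi>0)"
    if "e1 \<in> UNIV \<rightarrow> carrier M" "e2 \<in> UNIV \<rightarrow> carrier M" "e3 \<in> UNIV \<rightarrow> carrier M"
      "sat M e1 (foldr And \<phi>s \<phi>0)" "sat M e2 (foldr And \<phi>s \<phi>0)" "sat M e3 (foldr And \<phi>s \<phi>0)"
    for e1 e2 e3
    using atoms(1) that(4-6)
    by (induction \<phi>s) (use atoms(2) in \<open>auto simp: atomic_def trm[OF that(1-3)]\<close>)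
  show ?thesis
    using assms(4-) unfolding \<phi>
  proof (induction xs arbitrary: e1 e2 e3)
    case Nil
    then show ?case
      using conj by simp
  next
    case (Cons x xs)
    let ?\<psi> = "foldr Ex xs (foldr And \<phi>s \<phi>0)"
    obtain a1 a2 a3 where a: "{a1, a2, a3} \<subseteq> carrier M"
        "sat M (e1(x := a1)) ?\<psi>" "sat M (e2(x := a2)) ?\<psi>" "sat M (e3(x := a3)) ?\<psi>"
      using Cons.prems by auto
    have "sat M (\<lambda>i. m ((e1(x := a1)) i) ((e2(x := a2)) i) ((e3(x := a3)) i)) ?\<psi>"
      by (rule Cons.IH[OF env_upd env_upd env_upd]) (use a Cons.prems(1-3) in blast)+
    also have "(\<lambda>i. m ((e1(x := a1)) i) ((e2(x := a2)) i) ((e3(x := a3)) i)) =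
        (\<lambda>i. m (e1 i) (e2 i) (e3 i))(x := m a1 a2 a3)"
      by auto
    finally have "sat M ((\<lambda>i. m (e1 i) (e2 i) (e3 i))(x := m a1 a2 a3)) ?\<psi>" .
    moreover have "m a1 a2 a3 \<in> carrier M"
      using m a(1) by (simp add: polymorphism_def)
    ultimately show ?case
      unfolding foldr.simps comp_apply sat.simps by (rule bexI)
  qed
qed

lemma polymorphism_holds:
  assumes M: "is_structure M" and m: "polymorphism M m"
    and \<Phi>: "primitive \<Phi>" "fv \<Phi> \<subseteq> {..<n}"
    and lists: "bs \<in> tuples M n" "cs \<in> tuples M n" "ds \<in> tuples M n" "length as = n"
    and as: "\<And>i. i < n \<Longrightarrow> as ! i = m (bs ! i) (cs ! i) (ds ! i)"
    and sat: "holds M \<Phi> bs" "holds M \<Phi> cs" "holds M \<Phi> ds"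
  shows "holds M \<Phi> as"
proof -
  obtain a where a: "a \<in> carrier M"
    using M by (auto simp: is_structure_def)
  define env where "env xs i = (if i < n then xs ! i else a)" for xs i
  have env_in: "env xs \<in> UNIV \<rightarrow> carrier M" if "xs \<in> tuples M n" for xs
    using that a by (auto simp: env_def tuples_def)
  have env: "sat M ((!) xs) \<Phi> \<longleftrightarrow> sat M (env xs) \<Phi>" for xs
    by (rule sat_cong) (use \<Phi>(2) in \<open>auto simp: env_def\<close>)
  have "sat M (\<lambda>i. m (env bs i) (env cs i) (env ds i)) \<Phi>"
    by (rule polymorphism_primitive[OF M m \<Phi>(1)])
      (use sat lists env_in in \<open>auto simp: holds_def env\<close>)
  also have "sat M (\<lambda>i. m (env bs i) (env cs i) (env ds i)) \<Phi> \<longleftrightarrow> sat M ((!) as) \<Phi>"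
    by (rule sat_cong) (use \<Phi>(2) as in \<open>auto simp: env_def\<close>)
  finally show ?thesis
    by (simp add: holds_def)
qed

text \<open>
  By axiomatizability the large models of a completion of the theory of regular acts are themselves
  regular acts, so that they carry the majority operation.
\<close>

theorem theorem3p6:
  assumes universe: "(UNIV :: ('s::comm_monoid_mult + nat) set set) \<lesssim> (UNIV :: 'u set)"
    and R_nonempty: "(regular_part :: 's set) \<noteq> {}"
    and axiomatizable: "axiomatizable (regular_acts :: ('s, 'u) struct set)"
    and primitive_normal: "primitive_normal_class (regular_acts :: ('s, 'u) struct set)"
  shows "antiadditive_class (regular_acts :: ('s, 'u) struct set)"
  unfolding antiadditive_class_def antiadditive_def
proof (intro allI impI conjI)
  fix T :: "'s fm set"
  assume T: "completion (regular_acts :: ('s, 'u) struct set) T"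
  then show "primitive_normal TYPE('u) T"
    using primitive_normal by (simp add: primitive_normal_class_def)
  fix C :: "('s, 'u) struct"
  assume C: "monster T C"
  obtain \<Gamma> where \<Gamma>: "\<Gamma> \<subseteq> sentences" "(regular_acts :: ('s, 'u) struct set) = {M. models M \<Gamma>}"
    using axiomatizable unfolding axiomatizable_def by blast
  have "\<Gamma> \<subseteq> theory_of (regular_acts :: ('s, 'u) struct set)"
    using \<Gamma> by (auto simp: theory_of_def models_def)
  then have "models C \<Gamma>"
    using T C by (auto simp: completion_def monster_def models_def)
  then have reg: "regular_act C"
    using \<Gamma>(2) by (auto simp: regular_acts_def)
  then have act: "s_act C"
    by (simp add: regular_act_def)
  have "polymorphism C (majority C)"
    unfolding polymorphism_def
  proof (intro ballI conjI allI)
    fix x y z s assume "x \<in> carrier C" "y \<in> carrier C" "z \<in> carrier C"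
    then have xyz: "{x, y, z} \<subseteq> carrier C"
      by blast
    then show "majority C x y z \<in> carrier C"
      using majority_in[of C x y z] by auto
    show "majority C (interp C s x) (interp C s y) (interp C s z) = interp C s (majority C x y z)"
      by (rule majority_interp[OF act xyz comparable_on_triples[OF universe primitive_normal reg xyz]])
  qed
  note majority = s_actD(1)[OF act] this
  show "\<not> (\<exists>n X \<alpha> add zero. gen_primitive C n X \<alpha> \<and> infinite (X // \<alpha>) \<and>
    primitive_operation C n X \<alpha> add \<and> comm_group \<lparr>carrier = X // \<alpha>, mult = add, one = zero\<rparr>)"
  proof (safe)
    fix n X \<alpha> add zero
    assume gen: "gen_primitive C n X \<alpha>" and inf: "infinite (X // \<alpha>)"
      and op: "primitive_operation C n X \<alpha> add"
      and group: "comm_group \<lparr>carrier = X // \<alpha>, mult = add, one = zero\<rparr>" (is "comm_group ?G")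
    interpret comm_group ?G
      by (fact group)
    have X: "X \<subseteq> tuples C n"
      using gen by (auto simp: gen_primitive_def primitive_equivalence_def eq_dom_def)
    obtain \<Phi> m as where as: "as \<in> tuples C m" and \<Phi>: "primitive \<Phi>" "fv \<Phi> \<subseteq> {..<n + n + n + m}"
      and add: "\<And>b c d. b \<in> X \<Longrightarrow> c \<in> X \<Longrightarrow> d \<in> X \<Longrightarrow>
        add (\<alpha> `` {b}) (\<alpha> `` {c}) = \<alpha> `` {d} \<longleftrightarrow> holds C \<Phi> (b @ c @ d @ as)"
      using op unfolding primitive_operation_def by blast
    have zero: "zero \<in> X // \<alpha>"
      using one_closed by simp
    moreover obtain g where "g \<in> X // \<alpha>" "g \<noteq> zero"
      using inf by (metis finite.emptyI finite_insert finite_subset insertI1 subsetI singletonD)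
    ultimately obtain b c where b: "b \<in> X" "zero = \<alpha> `` {b}" and c: "c \<in> X" "g = \<alpha> `` {c}"
      by (auto elim!: quotientE)
    have g: "add zero zero = zero" "add zero g = g" "add g zero = g"
      using l_one[of zero] l_one[of g] r_one[of g] zero \<open>g \<in> X // \<alpha>\<close> by simp_all
    have bc: "b \<in> tuples C n" "c \<in> tuples C n"
      using b c X by auto
    then have len: "length b = n" "length c = n" "length as = m"
      using as by (auto simp: tuples_def)
    \<comment> \<open>With \<open>b\<close> and \<open>c\<close> representing \<open>0\<close> and \<open>g\<close>: the majority of \<open>0 + 0 = 0\<close>, \<open>0 + g = g\<close> and
      \<open>g + 0 = g\<close> is \<open>0 + 0 = g\<close>.\<close>
    have "holds C \<Phi> (b @ b @ c @ as)"
    proof (rule polymorphism_holds[OF majority \<Phi>])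
      show "holds C \<Phi> (b @ b @ b @ as)" "holds C \<Phi> (b @ c @ c @ as)" "holds C \<Phi> (c @ b @ c @ as)"
        using add b c g by auto
      show "(b @ b @ c @ as) ! i = majority C ((b @ b @ b @ as) ! i) ((b @ c @ c @ as) ! i)
          ((c @ b @ c @ as) ! i)" if "i < n + n + n + m" for i
        using that bc len
        by (auto simp: nth_append majority_simps(1,2) tuples_def
            intro!: majority_simps(3)[OF act, symmetric])
    qed (use bc as len in \<open>auto simp: tuples_def\<close>)
    then show False
      using add b c g \<open>g \<noteq> zero\<close> by metis
  qed
qed

end
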